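(* Let $\Gamma=(X_i,A_i,B_i,P_i)_{i\in I}$ be an abstract economy such that for each $i\in I$ the following conditions hold, where $X:=\prod_{i\in I}X_i$: 1) $X_i$ is a nonempty convex subset of a Hausdorff locally convex topological vector space $E_i$ and $D_i$ is a nonempty compact convex subset of $X_i$; 2) for each $x\in X$, $A_i(x)$ and $P_i(x)$ are convex, $B_i(x)$ is nonempty and convex, and $A_i(x)\cap P_i(x)\subset B_i(x)$; 3) $W_i:=\{x\in X: A_i(x)\cap P_i(x)\neq\emptyset\}$ is open in $X$; 4) the map $H_i$ defined by $H_i(x):=A_i(x)\cap P_i(x)$, restricted to $W_i$, i.e. $H_i:W_i\rightrightarrows X_i$, is almost w-upper semicontinuous with respect to $D_i$, and $\overline{H_i^{V_i}}$ has nonempty convex values on $W_i$ for each open absolutely convex symmetric neighborhood $V_i$ of $0$ in $E_i$; 5) $B_i:X\rightrightarrows X_i$ is almost w-upper semicontinuous with respect to $D_i$, and $\overline{B_i^{V_i}}$ has nonempty convex values for each open absolutely convex symmetric neighborhood $V_i$ of $0$ in $E_i$; 6) for each $x\in X$, $x_i\notin\overline{(A_i\cap P_i)}(x)$. Then there exists $x^{*}\in D=\prod_{i\in I}D_i$ such that $x_i^{*}\in\overline{B_i}(x^{*})$ and $(A_i\cap P_i)(x^{*})=\emptyset$ for each $i\in I$.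
   Context: A set valued map $T:X\rightrightarrows Y$ assigns to each $x\in X$ a (possibly empty) subset $T(x)\subseteq Y$; its graph is $\mathrm{Gr}(T)=\{(x,y)\in X\times Y: y\in T(x)\}$. For topological spaces $X,Y$, the map $\overline{T}:X\rightrightarrows Y$ is defined by $\overline{T}(x):=\{y\in Y:(x,y)\in \mathrm{cl}_{X\times Y}\mathrm{Gr}(T)\}$. For two such maps, $(F\cap G)(x)=F(x)\cap G(x)$. $T$ is upper semicontinuous if for each $x\in X$ and each open $V\subseteq Y$ with $T(x)\subseteq V$ there is an open neighborhood $U$ of $x$ with $T(y)\subseteq V$ for all $y\in U$. Let $X$ be a topological space, $Y$ a nonempty subset of a topological vector space $E$, $D\subseteq Y$, and $T:X\rightrightarrows Y$. For a neighborhood $V$ of $0$ in $E$, $T^{V}:X\rightrightarrows Y$ is defined by $T^{V}(x):=(T(x)+V)\cap D$; here $H_i^{V_i}(x)=(H_i(x)+V_i)\cap D_i$ and $B_i^{V_i}(x)=(B_i(x)+V_i)\cap D_i$. $T$ is almost w-upper semicontinuous with respect to $D$ if there exists a basis $\mathcal{B}$ of open symmetric neighborhoods of $0$ in $E$ such that, for each $V\in\mathcal{B}$, the set valued map $\overline{T^{V}}$ is upper semicontinuous. An abstract economy $(X_i,A_i,B_i,P_i)_{i\in I}$ consists of a nonempty set $I$ (agents) and, for each $i\in I$, a nonempty subset $X_i$ of a topological vector space and set valued maps $A_i,B_i,P_i:X=\prod_{j\in I}X_j\rightrightarrows X_i$ (two constraint maps $A_i,B_i$ and a preference map $P_i$).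 *)

theory Defs
  imports "HOL-Analysis.Analysis"
begin

(* The spaces E i of a family of topological vector spaces have to share one type 'e. They are
   linear subspaces of a common real vector space that has no topology of its own; each E i is
   given by an abstract topology whose topspace is that subspace. No generality is lost: any
   family of real vector spaces embeds linearly in its direct sum. *)

definition tvs_on :: "'e::real_vector topology \<Rightarrow> bool" where
  "tvs_on E \<longleftrightarrow>
     subspace (topspace E) \<and>
     continuous_map (prod_topology E E) E (\<lambda>(x, y). x + y) \<and>
     continuous_map (prod_topology euclideanreal E) E (\<lambda>(c, x). c *\<^sub>R x)"

definition locally_convex_tvs_on :: "'e::real_vector topology \<Rightarrow> bool" where
  "locally_convex_tvs_on E \<longleftrightarrow> tvs_on E \<and> neighbourhood_base_at 0 convex E"

definition symmetric_set :: "'e::real_vector set \<Rightarrow> bool" where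
  "symmetric_set V \<longleftrightarrow> uminus ` V = V"

definition balanced_set :: "'e::real_vector set \<Rightarrow> bool" where
  "balanced_set V \<longleftrightarrow> (\<forall>c. \<bar>c\<bar> \<le> 1 \<longrightarrow> (\<lambda>x. c *\<^sub>R x) ` V \<subseteq> V)"

definition absolutely_convex :: "'e::real_vector set \<Rightarrow> bool" where
  "absolutely_convex V \<longleftrightarrow> convex V \<and> balanced_set V"

definition open_symmetric_nhds_basis :: "'e::real_vector topology \<Rightarrow> 'e set set \<Rightarrow> bool" where
  "open_symmetric_nhds_basis E \<B> \<longleftrightarrow>
     (\<forall>V\<in>\<B>. openin E V \<and> 0 \<in> V \<and> symmetric_set V) \<and>
     (\<forall>N. openin E N \<and> 0 \<in> N \<longrightarrow> (\<exists>V\<in>\<B>. V \<subseteq> N))"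

(* A set valued map between topological spaces is a set valued function together with the
   topologies of its domain and codomain; only its values on topspace S matter. *)

definition closure_map ::
  "'x topology \<Rightarrow> 'y topology \<Rightarrow> ('x \<Rightarrow> 'y set) \<Rightarrow> 'x \<Rightarrow> 'y set" where
  "closure_map S Y T x =
     {y \<in> topspace Y. (x, y) \<in> prod_topology S Y closure_of (Sigma (topspace S) T)}"

definition upper_semicontinuous_map ::
  "'x topology \<Rightarrow> 'y topology \<Rightarrow> ('x \<Rightarrow> 'y set) \<Rightarrow> bool" where
  "upper_semicontinuous_map S Y T \<longleftrightarrow>
     (\<forall>x\<in>topspace S. \<forall>V. openin Y V \<and> T x \<subseteq> V \<longrightarrow>
        (\<exists>U. openin S U \<and> x \<in> U \<and> (\<forall>y\<in>U. T y \<subseteq> V)))"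

definition thickened_map ::
  "('x \<Rightarrow> 'e::real_vector set) \<Rightarrow> 'e set \<Rightarrow> 'e set \<Rightarrow> 'x \<Rightarrow> 'e set" where
  "thickened_map T V D x = (T x + V) \<inter> D"

(* The codomain of T is the subset Y of E with the subspace topology. *)

definition almost_w_usc ::
  "'x topology \<Rightarrow> 'e::real_vector topology \<Rightarrow> 'e set \<Rightarrow> 'e set \<Rightarrow> ('x \<Rightarrow> 'e set) \<Rightarrow> bool" where
  "almost_w_usc S E Y D T \<longleftrightarrow>
     (\<exists>\<B>. open_symmetric_nhds_basis E \<B> \<and>
        (\<forall>V\<in>\<B>. upper_semicontinuous_map S (subtopology E Y)
                  (closure_map S (subtopology E Y) (thickened_map T V D))))"

definition choice_topology ::
  "'i set \<Rightarrow> ('i \<Rightarrow> 'e topology) \<Rightarrow> ('i \<Rightarrow> 'e set) \<Rightarrow> ('i \<Rightarrow> 'e) topology" where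
  "choice_topology I E X = product_topology (\<lambda>i. subtopology (E i) (X i)) I"

definition abstract_economy ::
  "'i set \<Rightarrow> ('i \<Rightarrow> 'e::real_vector topology) \<Rightarrow> ('i \<Rightarrow> 'e set) \<Rightarrow>
   ('i \<Rightarrow> ('i \<Rightarrow> 'e) \<Rightarrow> 'e set) \<Rightarrow> ('i \<Rightarrow> ('i \<Rightarrow> 'e) \<Rightarrow> 'e set) \<Rightarrow>
   ('i \<Rightarrow> ('i \<Rightarrow> 'e) \<Rightarrow> 'e set) \<Rightarrow> bool" where
  "abstract_economy I E X A B P \<longleftrightarrow>
     I \<noteq> {} \<and>
     (\<forall>i\<in>I. tvs_on (E i) \<and> X i \<noteq> {} \<and> X i \<subseteq> topspace (E i) \<and>
        A i \<in> Pi\<^sub>E I X \<rightarrow> Pow (X i) \<and>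
        B i \<in> Pi\<^sub>E I X \<rightarrow> Pow (X i) \<and>
        P i \<in> Pi\<^sub>E I X \<rightarrow> Pow (X i))"

end

(*
  For absolutely convex neighbourhoods V_i of 0 let S_i(x) be the value at x of the closure of
  H_i^{V_i} if x lies in W_i, and of the closure of B_i^{V_i} otherwise. As W_i is open and H_i is
  contained in B_i, the graph of S_i is closed, so the Kakutani-Fan-Glicksberg theorem on the compact
  set D gives a point x with x_i in S_i(x) for all i. The sets of such points, for varying i and V_i,
  are closed and have the finite intersection property. At a common point x of all of them, shrinking
  V_i shows that x_i belongs to the closure of B_i at x, and that it would belong to the closure of
  A_i \<inter> P_i at x if x were in W_i, which is excluded by assumption.
*)
theory Submission
  imports Defs
begin

section \<open>Brouwer's theorem and open covers of the simplex\<close>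

text \<open>The factors \<open>D i\<close> lie in different topologised subspaces \<open>E i\<close>
  of one vector space without a topology, so the fixed point theorem is proved directly for such
  products and not for a convex subset of a single space. It is reduced to Brouwer's theorem in a
  dimension given by the size of a finite cover. The obstacle in this reduction is that a point
  which is not a fixed point fails in some coordinate, and this coordinate changes from point to
  point. Point-star refinements remove it: all cells around one point fit into one neighbourhood, on
  which one coordinate and one convex set suffice.

  The thickening by V_i is there because nonempty convex values are assumed for the closures of the
  thickened maps only. Fixed points for different V_i can be combined since the values of S_i grow
  with V_i: finitely many demands on one agent follow from the demand for the intersection of the
  neighbourhoods.\<close>

definition unit_cube :: "nat \<Rightarrow> (nat \<Rightarrow> real) set" where
  "unit_cube n = {a. (\<forall>k<n. 0 \<le> a k \<and> a k \<le> 1) \<and> (\<forall>k\<ge>n. a k = 0)}"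

text \<open>As in the cube, points vanish from \<open>n\<close> on, so that all dimensions share the
  one metrisable space of real sequences. The vertices are numbered by the indices below
  \<open>n\<close>; the dimension is \<open>n - 1\<close>.\<close>

definition unit_simplex :: "nat \<Rightarrow> (nat \<Rightarrow> real) set" where
  "unit_simplex n = {a. (\<forall>k<n. 0 \<le> a k) \<and> (\<forall>k\<ge>n. a k = 0) \<and> sum a {..<n} = 1}"

lemma LIMSEQ_fun_iff:
  fixes x :: "nat \<Rightarrow> 'a \<Rightarrow> 'b::topological_space"
  shows "x \<longlonglongrightarrow> l \<longleftrightarrow> (\<forall>k. (\<lambda>m. x m k) \<longlonglongrightarrow> l k)"
proof -
  have "x \<longlonglongrightarrow> l \<longleftrightarrow> limitin euclidean x l sequentially"
    by simp
  also have "\<dots> \<longleftrightarrow> (\<forall>k. (\<lambda>m. x m k) \<longlonglongrightarrow> l k)"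
    unfolding euclidean_product_topology[symmetric] limitin_componentwise by simp
  finally show ?thesis .
qed

lemma compact_unit_cube: "compact (unit_cube n)"
proof -
  let ?K = "\<lambda>k. if k < n then {0..1} else {0::real}"
  have "a \<in> unit_cube n \<longleftrightarrow> (\<forall>k. a k \<in> ?K k)" for a
    unfolding unit_cube_def mem_Collect_eq by (metis (full_types) atLeastAtMost_iff not_less singleton_iff)
  then have "unit_cube n = PiE UNIV ?K"
    by (simp add: set_eq_iff PiE_UNIV_domain Pi_iff)
  moreover have "compactin (product_topology (\<lambda>_. euclideanreal) UNIV) (PiE UNIV ?K)"
    unfolding compactin_PiE by simp
  ultimately show ?thesis
    by (simp add: euclidean_product_topology)
qed

text \<open>The library version of Brouwer's theorem has the dimension in the type; here it must depend on
  the size of a finite cover, so the argument from Kuhn's lemma is repeated for a variable \<open>n\<close>.\<close>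

lemma brouwer_unit_cube:
  assumes cont: "continuous_on (unit_cube n) f" and into: "f ` unit_cube n \<subseteq> unit_cube n"
  shows "\<exists>a\<in>unit_cube n. f a = a"
proof -
  define pt :: "nat \<Rightarrow> (nat \<Rightarrow> nat) \<Rightarrow> nat \<Rightarrow> real"
    where "pt m r = (\<lambda>k. if k < n then real (r k) / real (Suc m) else 0)" for m r
  have pt_cube: "pt m r \<in> unit_cube n" if "\<And>k. k < n \<Longrightarrow> r k \<le> Suc m" for m r
    using that by (simp add: unit_cube_def pt_def divide_le_eq del: of_nat_Suc)
  have f01: "0 \<le> f a k \<and> f a k \<le> 1" if "a \<in> unit_cube n" "k < n" for a k
  proof -
    have "f a \<in> unit_cube n" using into that by blast
    then show ?thesis using that by (simp add: unit_cube_def)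
  qed
  \<comment> \<open>\<open>near m q q\<close> merely says that \<open>q\<close> is a grid point. The
    bound forgets on which side of \<open>q\<close> the point \<open>r\<close> lies; only the
    distance matters in the limit.\<close>
  define near where "near m q r \<longleftrightarrow> (\<forall>k<n. r k \<le> Suc m \<and> \<bar>int (r k) - int (q k)\<bar> \<le> 1)"
    for m :: nat and q r :: "nat \<Rightarrow> nat"
  have near_cube: "pt m r \<in> unit_cube n" if "near m q r" for m q r
    using that by (simp add: near_def pt_cube)
  have "\<exists>q. near m q q \<and> (\<forall>i<n. \<exists>r s. near m q r \<and> near m q s \<and>
      pt m r i \<le> f (pt m r) i \<and> f (pt m s) i \<le> pt m s i)" for m
  proof -
    \<comment> \<open>Kuhn's lemma demands label 0 on the faces \<open>x i = 0\<close> and label 1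
      on the faces \<open>x i = Suc m\<close>. Both agree with the direction in which
      \<open>f\<close> moves the coordinate, because \<open>f\<close> cannot leave the cube.\<close>
    define label where "label x i =
      (if x i = 0 \<or> (x i < Suc m \<and> pt m x i \<le> f (pt m x) i) then 0 else 1::nat)" for x i
    have label0: "pt m x i \<le> f (pt m x) i"
      if "label x i = 0" "i < n" "\<And>k. k < n \<Longrightarrow> x k \<le> Suc m" for x i
      using that f01[OF pt_cube, of x m i] by (auto simp: label_def pt_def split: if_splits)
    have label1: "f (pt m x) i \<le> pt m x i"
      if "label x i \<noteq> 0" "i < n" "\<And>k. k < n \<Longrightarrow> x k \<le> Suc m" for x i
    proof (cases "x i = Suc m")
      case True
      then have "pt m x i = 1" using that by (simp add: pt_def del: of_nat_Suc)
      then show ?thesis using f01[OF pt_cube, of x m i] that by auto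
    next
      case False
      then show ?thesis using that(1) that(3)[OF that(2)] by (auto simp: label_def split: if_splits)
    qed
    obtain q where q: "\<forall>i<n. q i < Suc m"
      and rs: "\<forall>i<n. \<exists>r s. (\<forall>j<n. q j \<le> r j \<and> r j \<le> q j + 1) \<and>
                 (\<forall>j<n. q j \<le> s j \<and> s j \<le> q j + 1) \<and> label r i \<noteq> label s i"
      by (rule kuhn_lemma[of "Suc m" n label]) (simp_all add: label_def)
    have near: "near m q x" if "\<forall>j<n. q j \<le> x j \<and> x j \<le> q j + 1" for x
      unfolding near_def
    proof (intro allI impI)
      fix k assume "k < n"
      then have "q k < Suc m" "q k \<le> x k \<and> x k \<le> q k + 1" using q that by auto
      then show "x k \<le> Suc m \<and> \<bar>int (x k) - int (q k)\<bar> \<le> 1" by linarith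
    qed
    have "\<exists>r s. near m q r \<and> near m q s \<and>
      pt m r i \<le> f (pt m r) i \<and> f (pt m s) i \<le> pt m s i" if i: "i < n" for i
    proof -
      have witness: ?thesis
        if r: "\<forall>j<n. q j \<le> r j \<and> r j \<le> q j + 1" and s: "\<forall>j<n. q j \<le> s j \<and> s j \<le> q j + 1"
          and "label r i = 0" "label s i \<noteq> 0" for r s
      proof (intro exI conjI)
        show "near m q r" "near m q s" using near r s by auto
        then show "pt m r i \<le> f (pt m r) i" "f (pt m s) i \<le> pt m s i"
          using label0[OF that(3) i] label1[OF that(4) i] by (simp_all add: near_def)
      qed
      obtain r s where r: "\<forall>j<n. q j \<le> r j \<and> r j \<le> q j + 1"
        and s: "\<forall>j<n. q j \<le> s j \<and> s j \<le> q j + 1" and "label r i \<noteq> label s i"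
        using rs i by auto
      moreover from this have "label r i = 0 \<or> label s i = 0"
        unfolding label_def by presburger
      ultimately show ?thesis
        using witness[OF r s] witness[OF s r] by metis
    qed
    moreover have "near m q q" by (rule near) simp
    ultimately show ?thesis by blast
  qed
  then obtain q where q: "\<And>m. near m (q m) (q m)"
    and rs: "\<And>m i. i < n \<Longrightarrow> \<exists>r s. near m (q m) r \<and> near m (q m) s \<and>
      pt m r i \<le> f (pt m r) i \<and> f (pt m s) i \<le> pt m s i"
    by metis
  have "seq_compact (unit_cube n)"
    using compact_unit_cube compact_eq_seq_compact_metric by blast
  then obtain l \<sigma> where l: "l \<in> unit_cube n" and \<sigma>: "strict_mono \<sigma>"
    and "((\<lambda>m. pt m (q m)) \<circ> \<sigma>) \<longlonglongrightarrow> l"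
    by (rule seq_compactE[where f = "\<lambda>m. pt m (q m)"]) (use near_cube q in blast)
  then have lim: "(\<lambda>m. pt (\<sigma> m) (q (\<sigma> m))) \<longlonglongrightarrow> l"
    by (simp add: o_def)
  \<comment> \<open>The corners of the Kuhn cells depend on the coordinate under consideration, but
    all stay within one grid step of \<open>q\<close>, so they share its limit.\<close>
  have near_lim: "(\<lambda>m. pt (\<sigma> m) (r m)) \<longlonglongrightarrow> l"
    if r: "\<And>m. near (\<sigma> m) (q (\<sigma> m)) (r m)" for r
    unfolding LIMSEQ_fun_iff
  proof
    fix k
    have "(\<lambda>m. pt (\<sigma> m) (r m) k - pt (\<sigma> m) (q (\<sigma> m)) k) \<longlonglongrightarrow> 0"
    proof (rule Lim_null_comparison)
      show "(\<lambda>m. inverse (real (Suc (\<sigma> m)))) \<longlonglongrightarrow> 0"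
        using LIMSEQ_subseq_LIMSEQ[OF LIMSEQ_inverse_real_of_nat \<sigma>] by (simp add: o_def)
      have "norm (pt (\<sigma> m) (r m) k - pt (\<sigma> m) (q (\<sigma> m)) k) \<le> inverse (real (Suc (\<sigma> m)))" for m
      proof (cases "k < n")
        case True
        have "norm (pt (\<sigma> m) (r m) k - pt (\<sigma> m) (q (\<sigma> m)) k)
            = \<bar>real (r m k) - real (q (\<sigma> m) k)\<bar> / real (Suc (\<sigma> m))"
          using True by (simp add: pt_def abs_divide flip: diff_divide_distrib del: of_nat_Suc)
        also have "\<bar>int (r m k) - int (q (\<sigma> m) k)\<bar> \<le> 1"
          using r[of m] True unfolding near_def by simp
        then have "\<bar>real (r m k) - real (q (\<sigma> m) k)\<bar> \<le> 1"
          by linarith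
        then have "\<bar>real (r m k) - real (q (\<sigma> m) k)\<bar> / real (Suc (\<sigma> m)) \<le> inverse (real (Suc (\<sigma> m)))"
          by (simp add: inverse_eq_divide divide_right_mono del: of_nat_Suc)
        finally show ?thesis .
      qed (simp add: pt_def)
      then show "\<forall>\<^sub>F m in sequentially. norm (pt (\<sigma> m) (r m) k - pt (\<sigma> m) (q (\<sigma> m)) k)
          \<le> inverse (real (Suc (\<sigma> m)))"
        by simp
    qed
    moreover have "(\<lambda>m. pt (\<sigma> m) (q (\<sigma> m)) k) \<longlonglongrightarrow> l k"
      using lim by (simp add: LIMSEQ_fun_iff)
    ultimately show "(\<lambda>m. pt (\<sigma> m) (r m) k) \<longlonglongrightarrow> l k"
      using tendsto_add by fastforce
  qed
  have "f l i = l i" if i: "i < n" for i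
  proof -
    \<comment> \<open>Each coordinate has its own two corners: at one, \<open>f\<close> does not
      decrease it, at the other, \<open>f\<close> does not increase it. Both weak inequalities
      survive in the common limit \<open>l\<close>.\<close>
    obtain r s where r: "\<And>m. near m (q m) (r m)" and s: "\<And>m. near m (q m) (s m)"
      and fr: "\<And>m. pt m (r m) i \<le> f (pt m (r m)) i" and fs: "\<And>m. f (pt m (s m)) i \<le> pt m (s m) i"
      using rs[OF i] by metis
    have lims: "(\<lambda>m. pt (\<sigma> m) (t (\<sigma> m)) i) \<longlonglongrightarrow> l i" "(\<lambda>m. f (pt (\<sigma> m) (t (\<sigma> m))) i) \<longlonglongrightarrow> f l i"
      if t: "\<And>m. near m (q m) (t m)" for t
    proof -
      have *: "(\<lambda>m. pt (\<sigma> m) (t (\<sigma> m))) \<longlonglongrightarrow> l"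
        by (rule near_lim) (rule t)
      then show "(\<lambda>m. pt (\<sigma> m) (t (\<sigma> m)) i) \<longlonglongrightarrow> l i"
        by (simp add: LIMSEQ_fun_iff)
      have "(\<lambda>m. f (pt (\<sigma> m) (t (\<sigma> m)))) \<longlonglongrightarrow> f l"
        using t by (intro continuous_on_tendsto_compose[OF cont * l] always_eventually allI near_cube)
      then show "(\<lambda>m. f (pt (\<sigma> m) (t (\<sigma> m))) i) \<longlonglongrightarrow> f l i"
        by (simp add: LIMSEQ_fun_iff)
    qed
    have "l i \<le> f l i"
      by (rule LIMSEQ_le[OF lims(1)[OF r] lims(2)[OF r]]) (use fr in auto)
    moreover have "f l i \<le> l i"
      by (rule LIMSEQ_le[OF lims(2)[OF s] lims(1)[OF s]]) (use fs in auto)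
    ultimately show ?thesis by simp
  qed
  moreover have "f l i = l i" if "\<not> i < n" for i
  proof -
    have "f l \<in> unit_cube n" using into l by blast
    then show ?thesis using that l by (simp add: unit_cube_def)
  qed
  ultimately show ?thesis
    using l by blast
qed

text \<open>Dual form of the KKM lemma; the point is a fixed point of a partition of unity subordinate to the
  cover, extended to the cube by a retraction \<open>\<rho>\<close> onto the simplex.\<close>

lemma unit_simplex_open_cover:
  fixes U :: "nat \<Rightarrow> (nat \<Rightarrow> real) set"
  assumes op: "\<And>k. k < n \<Longrightarrow> openin (top_of_set (unit_simplex n)) (U k)"
    and cover: "unit_simplex n \<subseteq> (\<Union>k<n. U k)" and n: "n > 0"
  shows "\<exists>a\<in>unit_simplex n. \<forall>k<n. a k > 0 \<longrightarrow> a \<in> U k"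
proof -
  let ?\<Delta> = "unit_simplex n" and ?Q = "unit_cube n"
  have coord: "continuous_on S (\<lambda>a::nat \<Rightarrow> real. a k)" for S k
    by (rule continuous_on_subset[OF continuous_on_product_coordinates]) simp
  have \<Delta>Q: "?\<Delta> \<subseteq> ?Q"
  proof
    fix a assume a: "a \<in> ?\<Delta>"
    then have "a k \<le> 1" if "k < n" for k
      using member_le_sum[of k "{..<n}" a] that by (auto simp: unit_simplex_def)
    with a show "a \<in> ?Q" by (auto simp: unit_simplex_def unit_cube_def)
  qed
  \<comment> \<open>Mass missing from the total 1 is shared equally among the coordinates, excess
    mass is removed by scaling. At most one correction is active, and neither on the
    simplex.\<close>
  define \<rho> where "\<rho> a = (\<lambda>k. if k < n then (a k + max 0 (1 - sum a {..<n}) / n) / max 1 (sum a {..<n}) else 0)"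
    for a :: "nat \<Rightarrow> real"
  have \<rho>_cont: "continuous_on S \<rho>" for S
    unfolding \<rho>_def
  proof (intro continuous_on_coordinatewise_then_product)
    fix k
    show "continuous_on S (\<lambda>a. if k < n then (a k + max 0 (1 - sum a {..<n}) / n) / max 1 (sum a {..<n}) else 0)"
      by (cases "k < n") (auto intro!: continuous_intros coord)
  qed
  have \<rho>_id: "\<rho> a = a" if "a \<in> ?\<Delta>" for a
    using that by (auto simp: unit_simplex_def \<rho>_def fun_eq_iff)
  have \<rho>_into: "\<rho> a \<in> ?\<Delta>" if "a \<in> ?Q" for a
  proof -
    let ?s = "sum a {..<n}"
    have "sum (\<rho> a) {..<n} = (\<Sum>k<n. (a k + max 0 (1 - ?s) / n) / max 1 ?s)"
      by (simp add: \<rho>_def)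
    also have "\<dots> = (?s + max 0 (1 - ?s)) / max 1 ?s"
      using n by (simp add: sum.distrib flip: sum_divide_distrib)
    also have "\<dots> = 1" by (auto simp: max_def)
    finally show ?thesis
      using that by (auto simp: unit_simplex_def unit_cube_def \<rho>_def intro!: divide_nonneg_pos add_nonneg_nonneg)
  qed
  have "closed ?\<Delta>"
  proof -
    have "?\<Delta> = {a \<in> ?Q. sum a {..<n} = 1}"
      using \<Delta>Q by (auto simp: unit_simplex_def unit_cube_def)
    then show ?thesis
      using continuous_closed_preimage_constant[of ?Q "\<lambda>a. sum a {..<n}" 1] compact_unit_cube[of n]
      by (simp add: compact_imp_closed coord continuous_on_sum)
  qed
  text \<open>Since \<^term>\<open>infdist a {} = 0\<close>, a point outside the simplex is added to each complement.\<close>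
  define F where "F k = insert (\<lambda>_. 0) (?\<Delta> - U k)" for k
  have zero: "(\<lambda>_. 0) \<notin> ?\<Delta>" by (simp add: unit_simplex_def)
  have F_closed: "closed (F k)" if "k < n" for k
  proof -
    have "closedin (top_of_set ?\<Delta>) (?\<Delta> - U k)"
      using op[OF that] by (metis closedin_diff closedin_subtopology_refl topspace_euclidean_subtopology
          openin_closedin_eq subset_UNIV topspace_euclidean)
    then show ?thesis
      using \<open>closed ?\<Delta>\<close> by (simp add: F_def closedin_closed_eq)
  qed
  define u where "u k a = infdist a (F k)" for k a
  have u_pos: "u k a > 0 \<longleftrightarrow> a \<in> U k" if "k < n" "a \<in> ?\<Delta>" for k a
    using in_closed_iff_infdist_zero[OF F_closed[OF that(1)], of a] infdist_nonneg[of a "F k"] zero that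
    by (auto simp: u_def F_def)
  have u_nn: "u k a \<ge> 0" for k a by (simp add: u_def infdist_nonneg)
  have usum: "(\<Sum>k<n. u k a) > 0" if "a \<in> ?\<Delta>" for a
  proof -
    obtain k where "k < n" "a \<in> U k" using cover \<open>a \<in> ?\<Delta>\<close> by blast
    then show ?thesis using \<open>a \<in> ?\<Delta>\<close> u_nn u_pos by (auto intro!: sum_pos2[of _ k])
  qed
  define \<phi> where "\<phi> a = (\<lambda>k. if k < n then u k a / (\<Sum>k<n. u k a) else 0)" for a
  have \<phi>_cont: "continuous_on ?\<Delta> \<phi>"
    unfolding \<phi>_def
  proof (intro continuous_on_coordinatewise_then_product)
    fix k
    show "continuous_on ?\<Delta> (\<lambda>a. if k < n then u k a / (\<Sum>k<n. u k a) else 0)"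
      using usum by (cases "k < n") (fastforce simp: u_def intro!: continuous_intros)+
  qed
  have \<phi>_into: "\<phi> a \<in> ?\<Delta>" if "a \<in> ?\<Delta>" for a
    using usum[OF that] u_nn by (auto simp: \<phi>_def unit_simplex_def simp flip: sum_divide_distrib
        intro!: divide_nonneg_pos)
  obtain a where a: "a \<in> ?Q" "\<phi> (\<rho> a) = a"
  proof -
    have "continuous_on ?Q (\<lambda>a. \<phi> (\<rho> a))"
      using \<rho>_into by (intro continuous_on_compose2[OF \<phi>_cont \<rho>_cont]) auto
    then show ?thesis
      using brouwer_unit_cube[of n "\<lambda>a. \<phi> (\<rho> a)"] \<phi>_into \<rho>_into \<Delta>Q that by blast
  qed
  \<comment> \<open>Being a value of \<open>\<phi>\<close>, the fixed point lies in the simplex,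
    where \<open>\<rho>\<close> is the identity; so it is fixed by \<open>\<phi>\<close>
    alone.\<close>
  then have a\<Delta>: "a \<in> ?\<Delta>" using \<phi>_into \<rho>_into by metis
  with a have "\<phi> a = a" by (simp add: \<rho>_id)
  then have "u k a > 0" if "k < n" "a k > 0" for k
  proof -
    have "u k a / (\<Sum>k<n. u k a) = a k"
      using fun_cong[OF \<open>\<phi> a = a\<close>, of k] that by (simp add: \<phi>_def)
    then have "u k a \<noteq> 0" using that by auto
    then show ?thesis using u_nn[of k a] by simp
  qed
  then show ?thesis using u_pos a\<Delta> by blast
qed

section \<open>Point-star refinements\<close>

text \<open>Shrink the \<open>N z\<close> to a finite cover by closed sets \<open>C z\<close>; the cells cut out by the \<open>N z\<close> and the
  complements of the \<open>C z\<close> form the refinement.\<close>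

lemma point_star_refinement:
  assumes Z: "compact_space Z" "Hausdorff_space Z"
    and N: "\<And>z. z \<in> topspace Z \<Longrightarrow> openin Z (N z) \<and> z \<in> N z"
  obtains \<M> where "finite \<M>" "\<And>M. M \<in> \<M> \<Longrightarrow> openin Z M" "topspace Z \<subseteq> \<Union>\<M>"
    "\<And>x. x \<in> topspace Z \<Longrightarrow> \<exists>z\<in>topspace Z. \<forall>M\<in>\<M>. x \<in> M \<longrightarrow> M \<subseteq> N z"
proof -
  have "\<exists>G C. openin Z G \<and> closedin Z C \<and> z \<in> G \<and> G \<subseteq> C \<and> C \<subseteq> N z" if "z \<in> topspace Z" for z
  proof -
    have "neighbourhood_base_at z (closedin Z) Z"
      using compact_Hausdorff_imp_regular_space[OF Z] that
      by (simp add: neighbourhood_base_of_def flip: neighbourhood_base_of_closedin)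
    then show ?thesis
      using N[OF that] unfolding neighbourhood_base_at_def by meson
  qed
  then obtain G C where GC: "\<And>z. z \<in> topspace Z \<Longrightarrow> openin Z (G z) \<and> closedin Z (C z) \<and> z \<in> G z \<and> G z \<subseteq> C z \<and> C z \<subseteq> N z"
    by metis
  obtain \<F> where "finite \<F>" "\<F> \<subseteq> G ` topspace Z" "topspace Z \<subseteq> \<Union>\<F>"
    using Z(1)[unfolded compact_space_alt, rule_format, of "G ` topspace Z"] GC by blast
  then obtain T where T: "finite T" "T \<subseteq> topspace Z" and cover: "topspace Z \<subseteq> (\<Union>z\<in>T. G z)"
    by (metis finite_subset_image)
  define cell where "cell S = {x \<in> topspace Z. (\<forall>z\<in>S. x \<in> N z) \<and> (\<forall>z\<in>T - S. x \<notin> C z)}" for S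
  show ?thesis
  proof
    show "finite (cell ` Pow T)" using T by simp
    show "openin Z M" if "M \<in> cell ` Pow T" for M
    proof -
      obtain S where S: "S \<subseteq> T" and M: "M = cell S" using \<open>M \<in> cell ` Pow T\<close> by blast
      have "openin Z ((\<Inter>z\<in>S. N z) \<inter> topspace Z)"
        by (rule openin_INT) (use S T N finite_subset in blast)+
      moreover have "openin Z ((\<Inter>z\<in>T-S. topspace Z - C z) \<inter> topspace Z)"
        by (rule openin_INT) (use T GC openin_diff[OF openin_topspace] in blast)+
      moreover have "M = ((\<Inter>z\<in>S. N z) \<inter> topspace Z) \<inter> ((\<Inter>z\<in>T-S. topspace Z - C z) \<inter> topspace Z)"
        unfolding M cell_def by blast
      ultimately show ?thesis by (simp only: openin_Int)
    qed
    show "topspace Z \<subseteq> \<Union>(cell ` Pow T)"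
    proof
      fix x assume x: "x \<in> topspace Z"
      let ?S = "{z \<in> T. x \<in> C z}"
      have "x \<in> N z" if "z \<in> ?S" for z using that GC[of z] T(2) by blast
      then have "x \<in> cell ?S" using x unfolding cell_def by simp
      then show "x \<in> \<Union>(cell ` Pow T)" by (intro UN_I[of ?S]) simp_all
    qed
    show "\<exists>z\<in>topspace Z. \<forall>M\<in>cell ` Pow T. x \<in> M \<longrightarrow> M \<subseteq> N z" if "x \<in> topspace Z" for x
    proof -
      \<comment> \<open>A cell through a point of \<open>C z\<close> cannot have \<open>z\<close>
        among its excluded indices \<open>T - S\<close>, so \<open>z \<in> S\<close> and the cell
        lies in \<open>N z\<close>. Hence this one \<open>z\<close> serves all cells through
        \<open>x\<close>.\<close>
      obtain z where z: "z \<in> T" "x \<in> G z" using \<open>x \<in> topspace Z\<close> cover by blast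
      then have x: "x \<in> C z" and "z \<in> topspace Z" using GC[of z] T(2) by blast+
      have "M \<subseteq> N z" if M: "M \<in> cell ` Pow T" "x \<in> M" for M
      proof -
        obtain S where S: "M = cell S" using M by blast
        then have "z \<in> S" using M(2) z(1) x unfolding cell_def by blast
        then show ?thesis unfolding S cell_def by blast
      qed
      then show ?thesis using \<open>z \<in> topspace Z\<close> by blast
    qed
  qed
qed

section \<open>Locally convex topologies on subspaces\<close>

text \<open>The neighbourhoods over which the assumptions of nonempty convex values range. They are
  stable under finite intersections and, in a locally convex space, form a base at 0.\<close>

definition convex_nhd :: "'e::real_vector topology \<Rightarrow> 'e set \<Rightarrow> bool" where
  "convex_nhd E V \<longleftrightarrow> openin E V \<and> 0 \<in> V \<and> absolutely_convex V \<and> symmetric_set V"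

context
  fixes E :: "'e::real_vector topology"
  assumes tvs: "tvs_on E"
begin

lemma tvs_zero: "0 \<in> topspace E"
  and tvs_add_mem: "x \<in> topspace E \<Longrightarrow> y \<in> topspace E \<Longrightarrow> x + y \<in> topspace E"
  and tvs_scale_mem: "x \<in> topspace E \<Longrightarrow> c *\<^sub>R x \<in> topspace E"
  using tvs by (auto simp: tvs_on_def subspace_0 subspace_add subspace_scale)

lemma continuous_map_tvs_add:
  assumes "continuous_map Z E f" "continuous_map Z E g"
  shows "continuous_map Z E (\<lambda>x. f x + g x)"
proof -
  have "continuous_map Z E ((\<lambda>(x, y). x + y) \<circ> (\<lambda>x. (f x, g x)))"
    using assms tvs by (intro continuous_map_compose[of _ "prod_topology E E"])
      (auto simp: tvs_on_def continuous_map_pairedI)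
  then show ?thesis by (simp add: o_def)
qed

lemma continuous_map_tvs_scale:
  assumes "continuous_map Z euclideanreal c" "continuous_map Z E f"
  shows "continuous_map Z E (\<lambda>x. c x *\<^sub>R f x)"
proof -
  have "continuous_map Z E ((\<lambda>(c, x). c *\<^sub>R x) \<circ> (\<lambda>x. (c x, f x)))"
    using assms tvs by (intro continuous_map_compose[of _ "prod_topology euclideanreal E"])
      (auto simp: tvs_on_def continuous_map_pairedI)
  then show ?thesis by (simp add: o_def)
qed

lemma continuous_map_tvs_sum:
  assumes "\<And>k. k \<in> K \<Longrightarrow> continuous_map Z E (f k)"
  shows "continuous_map Z E (\<lambda>x. \<Sum>k\<in>K. f k x)"
  using assms
proof (induction K rule: infinite_finite_induct)
  case (insert k K)
  then show ?case by (simp add: continuous_map_tvs_add)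
qed (simp_all add: tvs_zero)

lemma openin_tvs_affine_preimage:
  assumes "openin E U" "a \<in> topspace E"
  shows "openin E {x \<in> topspace E. c *\<^sub>R x + a \<in> U}"
  using assms by (intro openin_continuous_map_preimage[OF _ assms(1)] continuous_map_tvs_add
      continuous_map_tvs_scale) auto

lemma openin_tvs_translate:
  assumes U: "openin E U" and a: "a \<in> topspace E"
  shows "openin E ((+) a ` U)"
proof -
  have "(+) a ` U = {x \<in> topspace E. 1 *\<^sub>R x + (-1) *\<^sub>R a \<in> U}"
    using openin_subset[OF U] tvs_add_mem[OF a] by (auto simp: image_iff) (metis add.commute diff_add_cancel)
  then show ?thesis
    using openin_tvs_affine_preimage[OF U tvs_scale_mem[OF a], of 1 "-1"] by metis
qed

lemma openin_tvs_scale: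
  assumes U: "openin E U" and c: "c \<noteq> 0"
  shows "openin E ((*\<^sub>R) c ` U)"
proof -
  have "(*\<^sub>R) c ` U = {x \<in> topspace E. inverse c *\<^sub>R x + 0 \<in> U}"
  proof (intro set_eqI iffI)
    fix x assume "x \<in> (*\<^sub>R) c ` U"
    then obtain u where "u \<in> U" "x = c *\<^sub>R u" by blast
    then show "x \<in> {x \<in> topspace E. inverse c *\<^sub>R x + 0 \<in> U}"
      using openin_subset[OF U] c tvs_scale_mem by auto
  next
    fix x assume "x \<in> {x \<in> topspace E. inverse c *\<^sub>R x + 0 \<in> U}"
    then have "inverse c *\<^sub>R x \<in> U" by simp
    moreover have "x = c *\<^sub>R (inverse c *\<^sub>R x)" using c by simp
    ultimately show "x \<in> (*\<^sub>R) c ` U" by (metis imageI)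
  qed
  then show ?thesis
    using openin_tvs_affine_preimage[OF U tvs_zero, of "inverse c"] by metis
qed

lemma openin_tvs_set_plus:
  assumes U: "openin E U" and S: "S \<subseteq> topspace E"
  shows "openin E (S + U)"
proof -
  have "S + U = \<Union>((\<lambda>s. (+) s ` U) ` S)" by (auto simp: set_plus_def)
  also have "openin E \<dots>"
    using openin_tvs_translate[OF U] S by (intro openin_Union) blast
  finally show ?thesis .
qed

lemma tvs_halving:
  assumes N: "openin E N" "0 \<in> N"
  obtains U where "openin E U" "0 \<in> U" "U + U \<subseteq> N"
proof -
  let ?P = "{p \<in> topspace (prod_topology E E). (\<lambda>(x, y). x + y) p \<in> N}"
  have "openin (prod_topology E E) ?P"
    using tvs N by (intro openin_continuous_map_preimage[of _ E]) (auto simp: tvs_on_def)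
  moreover have "(0, 0) \<in> ?P" using N tvs_zero by simp
  ultimately obtain U V where UV: "openin E U" "openin E V" "0 \<in> U" "0 \<in> V" "U \<times> V \<subseteq> ?P"
    unfolding openin_prod_topology_alt by meson
  have "(U \<inter> V) + (U \<inter> V) \<subseteq> N"
  proof
    fix z assume "z \<in> (U \<inter> V) + (U \<inter> V)"
    then obtain u v where "z = u + v" "(u, v) \<in> U \<times> V" by (auto elim: set_plus_elim)
    then show "z \<in> N" using UV(5) by auto
  qed
  then show ?thesis using that UV by (metis openin_Int IntI)
qed

end

section \<open>Absolutely convex neighbourhoods of zero\<close>

lemma absolutely_convex_Int:
  assumes "absolutely_convex U" "absolutely_convex V"
  shows "absolutely_convex (U \<inter> V)"
  using assms unfolding absolutely_convex_def balanced_set_def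
  by (simp add: convex_Int image_subset_iff)

lemma symmetric_set_iff: "symmetric_set V \<longleftrightarrow> (\<forall>x\<in>V. - x \<in> V)"
  unfolding symmetric_set_def by (metis (no_types, opaque_lifting) equalityI image_iff image_subset_iff minus_minus subsetI)

lemma convex_nhd_Int: "convex_nhd E U \<Longrightarrow> convex_nhd E V \<Longrightarrow> convex_nhd E (U \<inter> V)"
  by (auto simp: convex_nhd_def absolutely_convex_Int symmetric_set_iff)

text \<open>A convex set containing 0 is stable under scalars in [0,1], and a negative sign only
  exchanges \<open>C\<close> with its reflection.\<close>

lemma absolutely_convex_symmetrization:
  assumes "convex C" "0 \<in> C"
  shows "absolutely_convex (C \<inter> uminus ` C)"
  unfolding absolutely_convex_def balanced_set_def
proof (intro conjI allI impI subsetI)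
  let ?V = "C \<inter> uminus ` C"
  show "convex ?V" using assms by (intro convex_Int convex_negations)
  fix c x assume c: "\<bar>c\<bar> \<le> 1" and "x \<in> (*\<^sub>R) c ` ?V"
  then obtain y where "x = c *\<^sub>R y" "y \<in> ?V" by blast
  then have y: "x = c *\<^sub>R y" "y \<in> C" "- y \<in> C" by auto
  have shrink: "t *\<^sub>R z \<in> C" if "z \<in> C" "0 \<le> t" "t \<le> 1" for t z
    using convexD[OF assms(1) that(1) assms(2), of t "1 - t"] that by simp
  have "c *\<^sub>R y \<in> C \<and> - (c *\<^sub>R y) \<in> C"
  proof (cases "c \<ge> 0")
    case True
    then show ?thesis using shrink[of y c] shrink[of "-y" c] y c by simp
  next
    case False
    then show ?thesis using shrink[of y "-c"] shrink[of "-y" "-c"] y c by simp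
  qed
  then show "x \<in> ?V" using y(1) by (metis IntI image_eqI minus_minus)
qed

text \<open>For positive weights the weighted sum of two copies of the interior is open and
  contained in \<open>C\<close>, hence in the interior. A zero weight has to be split off, since
  scaling by 0 destroys openness.\<close>

lemma convex_interior_of:
  assumes E: "tvs_on E" and C: "convex C"
  shows "convex (E interior_of C)"
proof (rule convexI)
  fix x y and u v :: real
  assume xy: "x \<in> E interior_of C" "y \<in> E interior_of C" and uv: "0 \<le> u" "0 \<le> v" "u + v = 1"
  show "u *\<^sub>R x + v *\<^sub>R y \<in> E interior_of C"
  proof (cases "u = 0 \<or> v = 0")
    case True
    then show ?thesis using xy uv by auto
  next
    case False
    let ?O = "(*\<^sub>R) u ` (E interior_of C) + (*\<^sub>R) v ` (E interior_of C)"
    have "openin E ?O"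
      using False by (intro openin_tvs_set_plus[OF E] openin_tvs_scale[OF E] openin_subset) auto
    moreover have "?O \<subseteq> C"
    proof
      fix z assume "z \<in> ?O"
      then obtain p q where "z = u *\<^sub>R p + v *\<^sub>R q" "p \<in> C" "q \<in> C"
        using interior_of_subset[of E C] by (auto simp: set_plus_def)
      then show "z \<in> C" using convexD[OF C _ _ uv] by simp
    qed
    moreover have "u *\<^sub>R x + v *\<^sub>R y \<in> ?O" using xy by (auto simp: set_plus_def)
    ultimately show ?thesis using interior_of_maximal by blast
  qed
qed

text \<open>Local convexity supplies a convex set that merely contains an open neighbourhood;
  passing to its interior restores openness, and intersecting with the reflection makes it
  balanced.\<close>

lemma convex_nhd_base:
  assumes E: "locally_convex_tvs_on E" and N: "openin E N" "0 \<in> N"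
  obtains V where "convex_nhd E V" "V \<subseteq> N"
proof -
  have tvs: "tvs_on E" using E by (simp add: locally_convex_tvs_on_def)
  obtain U C where U: "openin E U" "0 \<in> U" "U \<subseteq> C" and C: "convex C" "C \<subseteq> N"
    using E N unfolding locally_convex_tvs_on_def neighbourhood_base_at_def by metis
  define V where "V = (E interior_of C) \<inter> uminus ` (E interior_of C)"
  have "0 \<in> E interior_of C" using U interior_of_maximal by blast
  moreover have "openin E (uminus ` (E interior_of C))"
    using openin_tvs_scale[OF tvs openin_interior_of, of "-1" C] by (simp add: scaleR_minus_left)
  ultimately have "convex_nhd E V"
    unfolding convex_nhd_def V_def symmetric_set_iff
    using absolutely_convex_symmetrization[OF convex_interior_of[OF tvs C(1)]]
    by (auto simp: image_iff)
  moreover have "V \<subseteq> N" using interior_of_subset[of E C] C by (auto simp: V_def)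
  ultimately show ?thesis by (rule that)
qed

lemma convex_nhd_halving:
  assumes E: "locally_convex_tvs_on E" and N: "openin E N" "0 \<in> N"
  obtains V where "convex_nhd E V" "V + V \<subseteq> N"
proof -
  obtain U where U: "openin E U" "0 \<in> U" "U + U \<subseteq> N"
    by (rule tvs_halving[OF _ N]) (use E in \<open>simp add: locally_convex_tvs_on_def\<close>)
  obtain V where V: "convex_nhd E V" "V \<subseteq> U"
    using convex_nhd_base[OF E U(1,2)] .
  then have "V + V \<subseteq> N" using order_trans[OF set_plus_mono2[OF V(2) V(2)] U(3)] by simp
  with V(1) show ?thesis by (rule that)
qed

section \<open>The Kakutani-Fan-Glicksberg theorem on products\<close>

text \<open>The link between the simplex and the product: with the \<open>n\<close> points held
  fixed, only the weights vary, so no continuity is asked of the choice of the points.\<close>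

lemma continuous_map_product_topology_tvs_comb:
  assumes E: "\<And>i. i \<in> I \<Longrightarrow> tvs_on (E i)" and D: "\<And>i. i \<in> I \<Longrightarrow> convex (D i)"
    and y: "\<And>k i. k < n \<Longrightarrow> i \<in> I \<Longrightarrow> y k i \<in> D i \<inter> topspace (E i)"
  shows "continuous_map (top_of_set (unit_simplex n)) (choice_topology I E D)
           (\<lambda>a. \<lambda>i\<in>I. \<Sum>k<n. a k *\<^sub>R y k i)"
  unfolding choice_topology_def continuous_map_componentwise
proof (intro conjI ballI)
  show "(\<lambda>a. \<lambda>i\<in>I. \<Sum>k<n. a k *\<^sub>R y k i) ` topspace (top_of_set (unit_simplex n)) \<subseteq> extensional I"
    by auto
  fix i assume i: "i \<in> I"
  have "continuous_map (top_of_set (unit_simplex n)) (E i) (\<lambda>a. \<Sum>k<n. a k *\<^sub>R y k i)"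
  proof (intro continuous_map_tvs_sum[OF E[OF i]] continuous_map_tvs_scale[OF E[OF i]])
    fix k assume k: "k \<in> {..<n}"
    show "continuous_map (top_of_set (unit_simplex n)) euclideanreal (\<lambda>a. a k)"
      unfolding continuous_map_iff_continuous
      by (rule continuous_on_subset[OF continuous_on_product_coordinates]) simp
    show "continuous_map (top_of_set (unit_simplex n)) (E i) (\<lambda>a. y k i)"
      using y[OF _ i] k by simp
  qed
  moreover have "(\<Sum>k<n. a k *\<^sub>R y k i) \<in> D i" if "a \<in> unit_simplex n" for a
    using that y[OF _ i] by (intro convex_sum D i) (auto simp: unit_simplex_def)
  ultimately show "continuous_map (top_of_set (unit_simplex n)) (subtopology (E i) (D i))
      (\<lambda>a. (\<lambda>i\<in>I. \<Sum>k<n. a k *\<^sub>R y k i) i)"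
    using i by (auto simp: continuous_map_in_subtopology)
qed

lemma choice_topology_compact_Hausdorff:
  assumes "\<And>i. i \<in> I \<Longrightarrow> Hausdorff_space (E i) \<and> compactin (E i) (D i)"
  shows "compact_space (choice_topology I E D)" "Hausdorff_space (choice_topology I E D)"
    "topspace (choice_topology I E D) = Pi\<^sub>E I D"
proof -
  show "compact_space (choice_topology I E D)"
    using assms by (simp add: choice_topology_def compact_space_product_topology compact_space_subtopology)
  show "Hausdorff_space (choice_topology I E D)"
    using assms by (simp add: choice_topology_def Hausdorff_space_product_topology Hausdorff_space_subtopology)
  show "topspace (choice_topology I E D) = Pi\<^sub>E I D"
  proof -
    have "topspace (subtopology (E i) (D i)) = D i" if "i \<in> I" for i
      using compactin_subset_topspace[of "E i" "D i"] assms[OF that] by auto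
    then show ?thesis
      unfolding choice_topology_def topspace_product_topology o_def by (intro PiE_cong)
  qed
qed

text \<open>A closed graph with values in a compact set gives upper semicontinuity, and local
  convexity separates \<open>p z\<close> from the closed convex set \<open>S z\<close>. In the
  application \<open>p\<close> is a coordinate projection.\<close>

lemma closed_graph_separation:
  assumes Z: "z \<in> topspace Z" and E: "locally_convex_tvs_on E" "Hausdorff_space E"
    and D: "compactin E D" and p: "continuous_map Z (subtopology E D) p"
    and S: "convex (S z)" "S z \<subseteq> D" "\<And>x. x \<in> topspace Z \<Longrightarrow> S x \<subseteq> D"
    and graph: "closedin (prod_topology Z (subtopology E D)) (Sigma (topspace Z) S)"
    and notin: "p z \<notin> S z"
  obtains N C where "openin Z N" "z \<in> N" "convex C" "\<And>x. x \<in> N \<Longrightarrow> p x \<notin> C \<and> S x \<subseteq> C"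
proof -
  have tvs: "tvs_on E" using E by (simp add: locally_convex_tvs_on_def)
  have DE: "D \<subseteq> topspace E" using D compactin_subset_topspace by blast
  have topD: "topspace (subtopology E D) = D" using DE by auto
  have pz: "p z \<in> topspace E"
    using p Z DE topD continuous_map_image_subset_topspace by fastforce
  have "closedin (subtopology E D) {y \<in> topspace (subtopology E D). (z, y) \<in> Sigma (topspace Z) S}"
    using Z by (intro closedin_continuous_map_preimage[OF _ graph] continuous_map_pairedI) auto
  moreover have "{y \<in> topspace (subtopology E D). (z, y) \<in> Sigma (topspace Z) S} = S z"
    using Z S(2) topD by auto
  moreover have "closedin E D" using compactin_imp_closedin[OF E(2) D] .
  ultimately have "closedin E (S z)" using closedin_trans_full by metis
  then have "openin E (topspace E - S z)" by blast
  then have "openin E {u \<in> topspace E. 1 *\<^sub>R u + p z \<in> topspace E - S z}"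
    by (rule openin_tvs_affine_preimage[OF tvs _ pz])
  moreover have "0 \<in> {u \<in> topspace E. 1 *\<^sub>R u + p z \<in> topspace E - S z}"
    using pz notin tvs_zero[OF tvs] by simp
  ultimately obtain V where V: "convex_nhd E V"
    and VV: "V + V \<subseteq> {u \<in> topspace E. 1 *\<^sub>R u + p z \<in> topspace E - S z}"
    by (rule convex_nhd_halving[OF E(1)])
  have V': "openin E V" "0 \<in> V" "convex V" "\<And>v. v \<in> V \<Longrightarrow> - v \<in> V"
    using V by (auto simp: convex_nhd_def absolutely_convex_def symmetric_set_iff)
  \<comment> \<open>The room for \<open>V + V\<close> makes this set disjoint from the translate of
    \<open>V\<close> to \<open>p z\<close>: a common point \<open>s + v = p z + w\<close> would give
    \<open>s = p z + (w - v)\<close>.\<close>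
  let ?C = "S z + V"
  have "openin E ?C" using S(2) DE by (intro openin_tvs_set_plus[OF tvs V'(1)]) auto
  have disj: "y \<notin> ?C" if "y \<in> (+) (p z) ` V" for y
  proof
    assume "y \<in> ?C"
    then obtain s v where sv: "s \<in> S z" "v \<in> V" "y = s + v" by (auto elim: set_plus_elim)
    obtain w where w: "w \<in> V" "y = p z + w" using \<open>y \<in> (+) (p z) ` V\<close> by blast
    have "w + (- v) \<in> V + V" using w sv V'(4) by (intro set_plus_intro) auto
    then have "1 *\<^sub>R (w + (- v)) + p z \<notin> S z" using VV by blast
    moreover have "1 *\<^sub>R (w + (- v)) + p z = s" using w(2) sv(3) by (simp add: algebra_simps)
    ultimately show False using sv(1) by simp
  qed
  \<comment> \<open>The points at which some value of \<open>S\<close> leaves \<open>?C\<close>. The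
    projection along the compact factor \<open>D\<close> is a closed map, so they form a closed
    set.\<close>
  let ?B = "fst ` (Sigma (topspace Z) S \<inter> (topspace Z \<times> (D - ?C)))"
  have "closedin Z ?B"
  proof -
    have "closedin (subtopology E D) (D - ?C)"
    proof -
      have "D - ?C = (topspace E - ?C) \<inter> D" using DE by blast
      moreover have "closedin E (topspace E - ?C)" using \<open>openin E ?C\<close> by blast
      ultimately show ?thesis unfolding closedin_subtopology by blast
    qed
    then have "closedin (prod_topology Z (subtopology E D)) (Sigma (topspace Z) S \<inter> (topspace Z \<times> (D - ?C)))"
      by (intro closedin_Int graph) (simp add: closedin_prod_Times_iff)
    then show ?thesis
      using closed_map_fst[of "subtopology E D" Z] D compact_space_subtopology
      unfolding closed_map_def by blast
  qed
  let ?N = "{x \<in> topspace Z. p x \<in> (+) (p z) ` V} \<inter> (topspace Z - ?B)"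
  show ?thesis
  proof
    have "openin Z {x \<in> topspace Z. p x \<in> (+) (p z) ` V}"
      using p openin_tvs_translate[OF tvs V'(1) pz]
      by (intro openin_continuous_map_preimage[of Z E p]) (auto simp: continuous_map_in_subtopology)
    then show "openin Z ?N" using \<open>closedin Z ?B\<close> by (intro openin_Int openin_diff) auto
    have "S z \<subseteq> ?C" using V'(2) by (force simp: set_plus_def)
    then show "z \<in> ?N" using Z V'(2) by (auto simp: image_iff)
    show "convex ?C" using S(1) V'(3) by (rule convex_set_plus)
    show "p x \<notin> ?C \<and> S x \<subseteq> ?C" if "x \<in> ?N" for x
    proof
      show "p x \<notin> ?C" using disj that by blast
      show "S x \<subseteq> ?C"
      proof
        fix y assume y: "y \<in> S x"
        show "y \<in> ?C"
        proof (rule ccontr)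
          assume "y \<notin> ?C"
          then have "(x, y) \<in> Sigma (topspace Z) S \<inter> (topspace Z \<times> (D - ?C))"
            using y S(3)[of x] that by blast
          then have "x \<in> ?B" by (metis fst_conv image_eqI)
          then show False using that by blast
        qed
      qed
    qed
  qed
qed

text \<open>Without a fixed point, every \<open>z\<close> has a neighbourhood \<open>N z\<close>, a coordinate \<open>j z\<close> and a convex set \<open>C z\<close>
  that contains all values of \<open>S (j z)\<close> on \<open>N z\<close> but no coordinate \<open>x (j z)\<close> with \<open>x \<in> N z\<close>. A convex
  combination \<open>x\<close> of values of \<open>S\<close> at points of those cells of a point-star refinement that contain \<open>x\<close>
  contradicts this.\<close>

theorem Kakutani_Fan_Glicksberg_product:
  fixes E :: "'i \<Rightarrow> 'e::real_vector topology"
  assumes E: "\<And>i. i \<in> I \<Longrightarrow> locally_convex_tvs_on (E i) \<and> Hausdorff_space (E i)"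
    and D: "\<And>i. i \<in> I \<Longrightarrow> D i \<noteq> {} \<and> compactin (E i) (D i) \<and> convex (D i)"
    and S: "\<And>i x. i \<in> I \<Longrightarrow> x \<in> Pi\<^sub>E I D \<Longrightarrow> S i x \<noteq> {} \<and> convex (S i x) \<and> S i x \<subseteq> D i"
    and graph: "\<And>i. i \<in> I \<Longrightarrow> closedin (prod_topology (choice_topology I E D) (subtopology (E i) (D i)))
                  (Sigma (Pi\<^sub>E I D) (S i))"
  shows "\<exists>x\<in>Pi\<^sub>E I D. \<forall>i\<in>I. x i \<in> S i x"
proof (rule ccontr)
  assume no_fp: "\<not> ?thesis"
  let ?Z = "choice_topology I E D"
  have Z: "compact_space ?Z" "Hausdorff_space ?Z" and topZ: "topspace ?Z = Pi\<^sub>E I D"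
    using choice_topology_compact_Hausdorff[of I E D] E D by auto
  have "\<exists>i N C. i \<in> I \<and> openin ?Z N \<and> z \<in> N \<and> convex C \<and> (\<forall>x\<in>N. x i \<notin> C \<and> S i x \<subseteq> C)"
    if z: "z \<in> Pi\<^sub>E I D" for z
  proof -
    obtain i where i: "i \<in> I" "z i \<notin> S i z" using no_fp z by blast
    have p: "continuous_map ?Z (subtopology (E i) (D i)) (\<lambda>x. x i)"
      unfolding choice_topology_def by (rule continuous_map_product_projection[OF i(1)])
    have graph': "closedin (prod_topology ?Z (subtopology (E i) (D i))) (Sigma (topspace ?Z) (S i))"
      unfolding topZ by (rule graph[OF i(1)])
    have zZ: "z \<in> topspace ?Z" using z topZ by simp
    have Sz: "convex (S i z)" "S i z \<subseteq> D i" using S[OF i(1) z] by simp_all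
    have SD: "S i x \<subseteq> D i" if "x \<in> topspace ?Z" for x using S[OF i(1)] that topZ by simp
    obtain N C where "openin ?Z N" "z \<in> N" "convex C" "\<And>x. x \<in> N \<Longrightarrow> x i \<notin> C \<and> S i x \<subseteq> C"
      by (rule closed_graph_separation[where z = z and Z = ?Z and E = "E i" and D = "D i"
            and p = "\<lambda>x. x i" and S = "S i", OF zZ _ _ _ p Sz SD graph' i(2)])
        (use E[OF i(1)] D[OF i(1)] in simp_all)
    with i(1) show ?thesis by (intro exI[of _ i] exI[of _ N] exI[of _ C]) simp
  qed
  then have "\<forall>z\<in>Pi\<^sub>E I D. \<exists>t. case t of (i, N, C) \<Rightarrow> i \<in> I \<and> openin ?Z N \<and> z \<in> N \<and> convex C
      \<and> (\<forall>x\<in>N. x i \<notin> C \<and> S i x \<subseteq> C)"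
    by (simp add: split_paired_Ex)
  from bchoice[OF this] obtain t where t: "\<forall>z\<in>Pi\<^sub>E I D. case t z of (i, N, C) \<Rightarrow> i \<in> I \<and> openin ?Z N
      \<and> z \<in> N \<and> convex C \<and> (\<forall>x\<in>N. x i \<notin> C \<and> S i x \<subseteq> C)" ..
  define j N C where "j z = fst (t z)" and "N z = fst (snd (t z))" and "C z = snd (snd (t z))" for z
  have jNC: "j z \<in> I \<and> openin ?Z (N z) \<and> z \<in> N z \<and> convex (C z)
      \<and> (\<forall>x\<in>N z. x (j z) \<notin> C z \<and> S (j z) x \<subseteq> C z)" if "z \<in> Pi\<^sub>E I D" for z
    using bspec[OF t that] unfolding j_def N_def C_def split_beta .
  have jN: "j z \<in> I" "openin ?Z (N z)" "z \<in> N z" and C: "convex (C z)"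
    and sep: "\<forall>x\<in>N z. x (j z) \<notin> C z \<and> S (j z) x \<subseteq> C z" if "z \<in> Pi\<^sub>E I D" for z
    using jNC[OF that] by - (elim conjE, assumption)+
  obtain \<M> where \<M>: "finite \<M>" "\<And>M. M \<in> \<M> \<Longrightarrow> openin ?Z M" "topspace ?Z \<subseteq> \<Union>\<M>"
    and star: "\<And>x. x \<in> topspace ?Z \<Longrightarrow> \<exists>z\<in>topspace ?Z. \<forall>M\<in>\<M>. x \<in> M \<longrightarrow> M \<subseteq> N z"
    by (rule point_star_refinement[OF Z, of N]) (use jN in \<open>simp_all add: topZ\<close>)
  \<comment> \<open>Empty cells are discarded so that a point \<open>w k\<close> can be chosen in
    every remaining one.\<close>
  obtain e :: "nat \<Rightarrow> ('i \<Rightarrow> 'e) set" and n where e: "\<M> - {{}} = e ` {..<n}"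
    using finite_imp_nat_seg_image_inj_on[of "\<M> - {{}}"] \<M>(1) unfolding lessThan_def by blast
  have eM: "e k \<in> \<M>" "e k \<noteq> {}" "openin ?Z (e k)" if "k < n" for k
    using e that \<M>(2) by blast+
  define w where "w k = (SOME x. x \<in> e k)" for k
  have w: "w k \<in> e k" "w k \<in> Pi\<^sub>E I D" if "k < n" for k
  proof -
    show "w k \<in> e k" using eM(2)[OF that] by (simp add: w_def some_in_eq)
    then show "w k \<in> Pi\<^sub>E I D" using openin_subset[OF eM(3)[OF that]] topZ by blast
  qed
  define y where "y k i = (SOME v. v \<in> S i (w k))" for k i
  have y: "y k i \<in> S i (w k)" "y k i \<in> D i" if "k < n" "i \<in> I" for k i
  proof -
    show "y k i \<in> S i (w k)" using S[OF that(2) w(2)[OF that(1)]] by (simp add: y_def some_in_eq)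
    then show "y k i \<in> D i" using S[OF that(2) w(2)[OF that(1)]] by blast
  qed
  let ?\<Delta> = "unit_simplex n"
  define mix where "mix a = (\<lambda>i\<in>I. \<Sum>k<n. a k *\<^sub>R y k i)" for a
  have mix_cont: "continuous_map (top_of_set ?\<Delta>) ?Z mix"
    unfolding mix_def
  proof (rule continuous_map_product_topology_tvs_comb)
    show "y k i \<in> D i \<inter> topspace (E i)" if "k < n" "i \<in> I" for k i
      using y(2)[OF that] D[OF that(2)] compactin_subset_topspace by blast
  qed (use E D locally_convex_tvs_on_def in auto)
  have mix_K: "mix a \<in> Pi\<^sub>E I D" if "a \<in> ?\<Delta>" for a
    using continuous_map_image_subset_topspace[OF mix_cont] that unfolding topZ by auto
  have "n > 0"
  proof -
    have "Pi\<^sub>E I D \<noteq> {}" using D by (simp add: PiE_eq_empty_iff)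
    then have "\<M> - {{}} \<noteq> {}" using \<M>(3) topZ by blast
    then show ?thesis using e by auto
  qed
  \<comment> \<open>The cells are pulled back along \<open>mix\<close>; the covering lemma then
    makes \<open>mix a\<close> a combination in which only cells containing \<open>mix a\<close>
    itself carry weight.\<close>
  obtain a where a: "a \<in> ?\<Delta>" and sel: "\<And>k. k < n \<Longrightarrow> a k > 0 \<Longrightarrow> mix a \<in> e k"
  proof -
    have "\<exists>a\<in>?\<Delta>. \<forall>k<n. a k > 0 \<longrightarrow> a \<in> {a \<in> ?\<Delta>. mix a \<in> e k}"
    proof (rule unit_simplex_open_cover[OF _ _ \<open>n > 0\<close>])
      show "openin (top_of_set ?\<Delta>) {a \<in> ?\<Delta>. mix a \<in> e k}" if "k < n" for k
        using openin_continuous_map_preimage[OF mix_cont eM(3)[OF that]] by simp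
      show "?\<Delta> \<subseteq> (\<Union>k<n. {a \<in> ?\<Delta>. mix a \<in> e k})"
      proof
        fix a assume a: "a \<in> ?\<Delta>"
        have "mix a \<in> \<Union>\<M>" using mix_K[OF a] by (rule subsetD[OF \<M>(3)[unfolded topZ]])
        then obtain M where M: "M \<in> \<M>" "mix a \<in> M" by (rule UnionE)
        then have "M \<in> e ` {..<n}" unfolding e[symmetric] by auto
        then obtain k where "k < n" "M = e k" by auto
        then show "a \<in> (\<Union>k<n. {a \<in> ?\<Delta>. mix a \<in> e k})" using a M(2) by simp blast
      qed
    qed
    then show ?thesis using that by blast
  qed
  define x where "x = mix a"
  have x: "x \<in> Pi\<^sub>E I D" using a mix_K by (simp add: x_def)
  obtain z where z: "z \<in> Pi\<^sub>E I D" "\<forall>M\<in>\<M>. x \<in> M \<longrightarrow> M \<subseteq> N z"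
    by (rule bexE[OF star[of x, unfolded topZ, OF x]])
  \<comment> \<open>All cells of positive weight contain \<open>x\<close> and therefore lie in the
    same \<open>N z\<close>, so the single set \<open>C z\<close> receives all the values being
    averaged.\<close>
  have Nz: "e k \<subseteq> N z" if "k < n" "a k > 0" for k
    using z(2) eM(1)[OF that(1)] sel[OF that] by (simp add: x_def)
  let ?P = "{k. k < n \<and> a k > 0}"
  have nn: "a k \<ge> 0" if "k < n" for k using a that by (simp add: unit_simplex_def)
  have zero: "a k = 0" if "k \<in> {..<n} - ?P" for k using nn[of k] that by auto
  have sum1: "sum a ?P = 1"
  proof -
    have "sum a ?P = sum a {..<n}" using zero by (intro sum.mono_neutral_left) auto
    then show ?thesis using a by (simp add: unit_simplex_def)
  qed
  then have "?P \<noteq> {}" by (metis sum.empty zero_neq_one)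
  then obtain k where k: "k < n" "a k > 0" by blast
  have "x \<in> e k" using sel[OF k] by (simp add: x_def)
  then have "x \<in> N z" by (rule subsetD[OF Nz[OF k]])
  then have xC: "x (j z) \<notin> C z" using sep[OF z(1)] by simp
  have jI: "j z \<in> I" by (rule jN(1)[OF z(1)])
  have "x (j z) = (\<Sum>k<n. a k *\<^sub>R y k (j z))" using jI by (simp add: x_def mix_def)
  also have "\<dots> = (\<Sum>k\<in>?P. a k *\<^sub>R y k (j z))"
    using zero by (intro sum.mono_neutral_right) auto
  also have "\<dots> \<in> C z"
  proof (rule convex_sum)
    show "convex (C z)" by (rule C[OF z(1)])
    show "finite ?P" by simp
    show "sum a ?P = 1" by (rule sum1)
    show "a k \<ge> 0" if "k \<in> ?P" for k using that by simp
    show "y k (j z) \<in> C z" if "k \<in> ?P" for k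
    proof -
      have k: "k < n" "a k > 0" using that by simp_all
      have "w k \<in> N z" using w(1)[OF k(1)] by (rule subsetD[OF Nz[OF k]])
      then have "S (j z) (w k) \<subseteq> C z" using sep[OF z(1)] by simp
      then show ?thesis using y(1)[OF k(1) jI] by (rule subsetD)
    qed
  qed
  finally have "x (j z) \<in> C z" .
  with xC show False by contradiction
qed

section \<open>Closures of thickened maps\<close>

lemma mem_closure_map_iff:
  "y \<in> closure_map S Y T x \<longleftrightarrow> (x, y) \<in> prod_topology S Y closure_of (Sigma (topspace S) T)"
  using closure_of_subset_topspace[of "prod_topology S Y" "Sigma (topspace S) T"]
  by (auto simp: closure_map_def)

text \<open>Closure in a subspace is the trace of the closure in the whole space. This lets
  \<open>H\<close>, which lives on \<open>W\<close>, be compared with \<open>B\<close>, which lives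
  on all of \<open>S\<close>.\<close>

lemma mem_closure_map_subtopology_iff:
  assumes W: "W \<subseteq> topspace S" and x: "x \<in> W"
  shows "y \<in> closure_map (subtopology S W) Y T x \<longleftrightarrow> (x, y) \<in> prod_topology S Y closure_of (Sigma W T)"
proof -
  let ?P = "prod_topology S Y"
  have "prod_topology (subtopology S W) Y closure_of (Sigma W T)
      = (W \<times> topspace Y) \<inter> ?P closure_of ((W \<times> topspace Y) \<inter> Sigma W T)"
    by (simp only: prod_topology_subtopology closure_of_subtopology)
  also have "(W \<times> topspace Y) \<inter> Sigma W T = topspace ?P \<inter> Sigma W T"
    using W by auto
  also have "?P closure_of \<dots> = ?P closure_of (Sigma W T)"
    by (rule closure_of_restrict[symmetric])
  finally have *: "prod_topology (subtopology S W) Y closure_of (Sigma W T)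
      = (W \<times> topspace Y) \<inter> ?P closure_of (Sigma W T)" .
  have "topspace (subtopology S W) = W" using W by auto
  moreover have "y \<in> topspace Y" if "(x, y) \<in> ?P closure_of (Sigma W T)"
    using that closure_of_subset_topspace[of ?P "Sigma W T"] by auto
  ultimately show ?thesis
    unfolding mem_closure_map_iff using * x by auto
qed

lemma closure_of_thickened_subset:
  assumes "closedin Y D" "A \<subseteq> topspace S"
  shows "prod_topology S Y closure_of (Sigma A (thickened_map T V D)) \<subseteq> topspace S \<times> D"
proof (rule closure_of_minimal)
  show "Sigma A (thickened_map T V D) \<subseteq> topspace S \<times> D"
    using assms(2) by (auto simp: thickened_map_def)
  show "closedin (prod_topology S Y) (topspace S \<times> D)"
    using assms(1) by (simp add: closedin_prod_Times_iff)
qed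

lemma thickened_map_mono: "T x \<subseteq> T' x \<Longrightarrow> V \<subseteq> V' \<Longrightarrow> thickened_map T V D x \<subseteq> thickened_map T' V' D x"
  unfolding thickened_map_def by (intro Int_mono set_plus_mono2) auto

text \<open>If a point \<open>(x', y')\<close> of the thickened graph is close to
  \<open>(x, y)\<close>, say \<open>y' = t + v = y + w\<close> with \<open>t \<in> T x'\<close>,
  then \<open>t = y + (w - v)\<close>. So \<open>(x', t)\<close> is a point of the graph of
  \<open>T\<close> whose second component differs from \<open>y\<close> by an element of
  \<open>V + V\<close>.\<close>

lemma closure_of_thickened_limit:
  assumes E: "locally_convex_tvs_on E" and X: "X \<subseteq> topspace E"
    and T: "\<And>x. x \<in> A \<Longrightarrow> T x \<subseteq> X"
    and all: "\<And>V. convex_nhd E V \<Longrightarrow>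
      (x, y) \<in> prod_topology S (subtopology E X) closure_of (Sigma A (thickened_map T V D))"
  shows "(x, y) \<in> prod_topology S (subtopology E X) closure_of (Sigma A T)"
proof -
  let ?P = "prod_topology S (subtopology E X)"
  have tvs: "tvs_on E" using E by (simp add: locally_convex_tvs_on_def)
  \<comment> \<open>The assumption speaks about \<open>(x, y)\<close> only through some
    \<open>V\<close>, so one such \<open>V\<close> is needed to place the point in the product
    space.\<close>
  obtain V0 where "convex_nhd E V0"
    using convex_nhd_base[OF E openin_topspace tvs_zero[OF tvs]] by metis
  then have top: "(x, y) \<in> topspace ?P"
    by (rule subsetD[OF closure_of_subset_topspace all])
  then have x: "x \<in> topspace S" and y: "y \<in> X" "y \<in> topspace E" by auto
  have "\<exists>p. p \<in> Sigma A T \<and> p \<in> G" if G: "(x, y) \<in> G" "openin ?P G" for G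
  proof -
    obtain U N where U: "openin S U" "x \<in> U" and N: "openin (subtopology E X) N" "y \<in> N" and UN: "U \<times> N \<subseteq> G"
      using G unfolding openin_prod_topology_alt by metis
    obtain N' where N': "openin E N'" "N = N' \<inter> X" using N(1) unfolding openin_subtopology by metis
    have "openin E {u \<in> topspace E. 1 *\<^sub>R u + y \<in> N'}"
      by (rule openin_tvs_affine_preimage[OF tvs N'(1) y(2)])
    moreover have "0 \<in> {u \<in> topspace E. 1 *\<^sub>R u + y \<in> N'}"
      using tvs_zero[OF tvs] N(2) N'(2) by simp
    ultimately obtain V where V: "convex_nhd E V" and VV: "V + V \<subseteq> {u \<in> topspace E. 1 *\<^sub>R u + y \<in> N'}"
      by (rule convex_nhd_halving[OF E])
    have V': "openin E V" "0 \<in> V" "\<And>v. v \<in> V \<Longrightarrow> - v \<in> V"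
      using V by (auto simp: convex_nhd_def symmetric_set_iff)
    let ?M = "(+) y ` V \<inter> X"
    have "openin (subtopology E X) ?M"
      using openin_tvs_translate[OF tvs V'(1) y(2)] by (rule openin_subtopology_Int)
    then have "openin ?P (U \<times> ?M)" using U(1) by (simp add: openin_prod_Times_iff)
    moreover have "y \<in> (+) y ` V" using V'(2) by (auto simp: image_iff)
    then have "(x, y) \<in> U \<times> ?M" using U(2) y(1) by simp
    ultimately obtain p where p: "p \<in> Sigma A (thickened_map T V D)" "p \<in> U \<times> ?M"
      using all[OF V] unfolding in_closure_of by metis
    obtain x' y' where p_eq: "p = (x', y')" by (cases p)
    have x': "x' \<in> A" "x' \<in> U" and "y' \<in> T x' + V" and "y' \<in> (+) y ` V"
      using p by (auto simp: p_eq thickened_map_def)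
    then obtain t v w where t: "t \<in> T x'" and v: "v \<in> V" "y' = t + v" and w: "w \<in> V" "y' = y + w"
      by (auto elim!: set_plus_elim)
    have "w + (- v) \<in> V + V" using w(1) V'(3)[OF v(1)] by (rule set_plus_intro)
    then have "1 *\<^sub>R (w + (- v)) + y \<in> N'" using VV by auto
    moreover have "1 *\<^sub>R (w + (- v)) + y = t" using v(2) w(2) by (simp add: algebra_simps)
    moreover have "t \<in> X" using T[OF x'(1)] t by (rule subsetD)
    ultimately have "(x', t) \<in> U \<times> N" using x'(2) N'(2) by simp
    then have "(x', t) \<in> G" by (rule subsetD[OF UN])
    then show ?thesis using x'(1) t by (intro exI[of _ "(x', t)"]) simp
  qed
  then show ?thesis unfolding in_closure_of using top by simp
qed

section \<open>The combined map and its closed graph\<close>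

definition selector_map ::
  "'x topology \<Rightarrow> 'e::real_vector topology \<Rightarrow> 'x set \<Rightarrow> ('x \<Rightarrow> 'e set) \<Rightarrow> ('x \<Rightarrow> 'e set) \<Rightarrow> 'e set
    \<Rightarrow> 'e set \<Rightarrow> 'x \<Rightarrow> 'e set" where
  "selector_map S Y W H B D V x =
     (if x \<in> W then closure_map (subtopology S W) Y (thickened_map H V D) x
      else closure_map S Y (thickened_map B V D) x)"

context
  fixes S :: "'x topology" and Y :: "'e::real_vector topology" and W :: "'x set" and H B :: "'x \<Rightarrow> 'e set"
    and D :: "'e set"
  assumes W: "openin S W" and HB: "\<And>x. x \<in> W \<Longrightarrow> H x \<subseteq> B x"
begin

lemma W_subset: "W \<subseteq> topspace S"
  using W by (rule openin_subset)

lemma closure_thickened_H_subset_B: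
  "prod_topology S Y closure_of (Sigma W (thickened_map H V D))
    \<subseteq> prod_topology S Y closure_of (Sigma (topspace S) (thickened_map B V D))"
proof (rule closure_of_mono, rule Sigma_mono[OF W_subset])
  show "thickened_map H V D x \<subseteq> thickened_map B V D x" if "x \<in> W" for x
    using HB[OF that] by (rule thickened_map_mono) (rule order_refl)
qed

text \<open>On \<open>W\<close> the second condition implies the first because \<open>H\<close> is
  contained in \<open>B\<close>. Keeping both turns the case distinction into a conjunction, whose
  parts are closed and monotone in \<open>V\<close>.\<close>

lemma mem_selector_map_iff:
  "y \<in> selector_map S Y W H B D V x \<longleftrightarrow>
     (x, y) \<in> prod_topology S Y closure_of (Sigma (topspace S) (thickened_map B V D)) \<and>
     (x \<in> W \<longrightarrow> (x, y) \<in> prod_topology S Y closure_of (Sigma W (thickened_map H V D)))"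
proof (cases "x \<in> W")
  case True
  then show ?thesis
    using mem_closure_map_subtopology_iff[OF W_subset True, of y Y] closure_thickened_H_subset_B[of V]
    by (auto simp: selector_map_def)
next
  case False
  then show ?thesis by (simp add: selector_map_def mem_closure_map_iff)
qed

text \<open>The implication with premise \<open>x \<in> W\<close> describes the union of the part
  over the complement of \<open>W\<close> with the closure of the graph of the thickened
  \<open>H\<close>. Openness of \<open>W\<close> makes the first of these closed.\<close>

lemma closedin_selector_graph:
  "closedin (prod_topology S Y) {p. snd p \<in> selector_map S Y W H B D V (fst p)}"
proof -
  let ?P = "prod_topology S Y"
  let ?clB = "?P closure_of (Sigma (topspace S) (thickened_map B V D))"
  let ?clH = "?P closure_of (Sigma W (thickened_map H V D))"
  have "closedin ?P ((topspace S - W) \<times> topspace Y)"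
    using W by (simp add: closedin_prod_Times_iff closedin_diff)
  then have "closedin ?P (?clB \<inter> ((topspace S - W) \<times> topspace Y \<union> ?clH))"
    by (intro closedin_Int closedin_Un closedin_closure_of)
  moreover have "{p. snd p \<in> selector_map S Y W H B D V (fst p)} = ?clB \<inter> ((topspace S - W) \<times> topspace Y \<union> ?clH)"
    (is "?L = ?R")
  proof (intro set_eqI)
    fix p :: "'x \<times> 'e"
    obtain x y where p: "p = (x, y)" by (cases p)
    have "(x, y) \<in> ?clB \<Longrightarrow> x \<in> topspace S \<and> y \<in> topspace Y"
      using closure_of_subset_topspace[of ?P "Sigma (topspace S) (thickened_map B V D)"] by auto
    moreover have "p \<in> ?L \<longleftrightarrow> (x, y) \<in> ?clB \<and> (x \<in> W \<longrightarrow> (x, y) \<in> ?clH)"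
      by (simp add: p mem_selector_map_iff)
    ultimately show "p \<in> ?L \<longleftrightarrow> p \<in> ?R" by (simp add: p) metis
  qed
  ultimately show ?thesis by simp
qed

lemma selector_map_subset:
  assumes "closedin Y D"
  shows "selector_map S Y W H B D V x \<subseteq> D"
  using closure_of_thickened_subset[OF assms order_refl, of S B V]
  by (auto simp: mem_selector_map_iff)

lemma selector_map_mono:
  assumes "V \<subseteq> V'"
  shows "selector_map S Y W H B D V x \<subseteq> selector_map S Y W H B D V' x"
proof -
  have "P closure_of (Sigma A (thickened_map T V D)) \<subseteq> P closure_of (Sigma A (thickened_map T V' D))"
    for P :: "('x \<times> 'e) topology" and A T
    by (intro closure_of_mono Sigma_mono order_refl thickened_map_mono assms)
  then show ?thesis unfolding mem_selector_map_iff subset_iff by metis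
qed

end

section \<open>Existence of the equilibrium\<close>

lemma continuous_map_choice_topology_mono:
  assumes "\<And>i. i \<in> I \<Longrightarrow> D i \<subseteq> X i"
  shows "continuous_map (choice_topology I E D) (choice_topology I E X) (\<lambda>x. x)"
  unfolding choice_topology_def continuous_map_componentwise
proof (intro conjI ballI)
  show "(\<lambda>x. x) ` topspace (product_topology (\<lambda>i. subtopology (E i) (D i)) I) \<subseteq> extensional I"
    by (auto simp: PiE_iff)
  fix i assume i: "i \<in> I"
  have "continuous_map (product_topology (\<lambda>i. subtopology (E i) (D i)) I) (subtopology (E i) (D i)) (\<lambda>x. x i)"
    by (rule continuous_map_product_projection[OF i])
  then show "continuous_map (product_topology (\<lambda>i. subtopology (E i) (D i)) I) (subtopology (E i) (X i)) (\<lambda>x. x i)"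
    using assms[OF i] by (auto simp: continuous_map_in_subtopology)
qed

lemma convex_nhd_topspace: "tvs_on E \<Longrightarrow> convex_nhd E (topspace E)"
  unfolding convex_nhd_def absolutely_convex_def balanced_set_def symmetric_set_iff
  by (auto simp: tvs_on_def subspace_0 subspace_scale subspace_neg subspace_imp_convex)

text \<open>The factor \<open>topspace E\<close> takes care of the empty family, whose intersection
  would be the whole ambient type.\<close>

lemma convex_nhd_Inter:
  assumes "tvs_on E" "finite \<V>" "\<And>V. V \<in> \<V> \<Longrightarrow> convex_nhd E V"
  shows "convex_nhd E (topspace E \<inter> \<Inter>\<V>)"
  using assms(2,3)
proof (induction \<V> rule: finite_induct)
  case empty
  then show ?case by (simp add: convex_nhd_topspace[OF assms(1)])
next
  case (insert V \<V>)
  have "topspace E \<inter> \<Inter>(insert V \<V>) = V \<inter> (topspace E \<inter> \<Inter>\<V>)" by auto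
  then show ?case using insert convex_nhd_Int[of E V] by simp
qed

theorem theorem4p1:
  fixes I :: "'i set"
    and E :: "'i \<Rightarrow> 'e::real_vector topology"
    and X D :: "'i \<Rightarrow> 'e set"
    and A B P H :: "'i \<Rightarrow> ('i \<Rightarrow> 'e) \<Rightarrow> 'e set"
    and W :: "'i \<Rightarrow> ('i \<Rightarrow> 'e) set"
  assumes economy: "abstract_economy I E X A B P"
    and H_def: "\<And>i x. i \<in> I \<Longrightarrow> x \<in> Pi\<^sub>E I X \<Longrightarrow> H i x = A i x \<inter> P i x"
    and W_def: "\<And>i. i \<in> I \<Longrightarrow> W i = {x \<in> Pi\<^sub>E I X. A i x \<inter> P i x \<noteq> {}}"
    and c1_E: "\<And>i. i \<in> I \<Longrightarrow> locally_convex_tvs_on (E i) \<and> Hausdorff_space (E i)"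
    and c1_X: "\<And>i. i \<in> I \<Longrightarrow> X i \<noteq> {} \<and> X i \<subseteq> topspace (E i) \<and> convex (X i)"
    and c1_D: "\<And>i. i \<in> I \<Longrightarrow> D i \<noteq> {} \<and> D i \<subseteq> X i \<and> compactin (E i) (D i) \<and> convex (D i)"
    and c2: "\<And>i x. i \<in> I \<Longrightarrow> x \<in> Pi\<^sub>E I X \<Longrightarrow>
               convex (A i x) \<and> convex (P i x) \<and> B i x \<noteq> {} \<and> convex (B i x) \<and>
               A i x \<inter> P i x \<subseteq> B i x"
    and c3: "\<And>i. i \<in> I \<Longrightarrow> openin (choice_topology I E X) (W i)"
    and c4_usc: "\<And>i. i \<in> I \<Longrightarrow>
               almost_w_usc (subtopology (choice_topology I E X) (W i)) (E i) (X i) (D i) (H i)"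
    and c4_conv: "\<And>i V x. i \<in> I \<Longrightarrow>
               openin (E i) V \<Longrightarrow> 0 \<in> V \<Longrightarrow> absolutely_convex V \<Longrightarrow> symmetric_set V \<Longrightarrow> x \<in> W i \<Longrightarrow>
               closure_map (subtopology (choice_topology I E X) (W i)) (subtopology (E i) (X i))
                 (thickened_map (H i) V (D i)) x \<noteq> {} \<and>
               convex (closure_map (subtopology (choice_topology I E X) (W i))
                 (subtopology (E i) (X i)) (thickened_map (H i) V (D i)) x)"
    and c5_usc: "\<And>i. i \<in> I \<Longrightarrow> almost_w_usc (choice_topology I E X) (E i) (X i) (D i) (B i)"
    and c5_conv: "\<And>i V x. i \<in> I \<Longrightarrow>
               openin (E i) V \<Longrightarrow> 0 \<in> V \<Longrightarrow> absolutely_convex V \<Longrightarrow> symmetric_set V \<Longrightarrow> x \<in> Pi\<^sub>E I X \<Longrightarrow>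
               closure_map (choice_topology I E X) (subtopology (E i) (X i))
                 (thickened_map (B i) V (D i)) x \<noteq> {} \<and>
               convex (closure_map (choice_topology I E X) (subtopology (E i) (X i))
                 (thickened_map (B i) V (D i)) x)"
    and c6: "\<And>i x. i \<in> I \<Longrightarrow> x \<in> Pi\<^sub>E I X \<Longrightarrow>
               x i \<notin> closure_map (choice_topology I E X) (subtopology (E i) (X i))
                       (\<lambda>z. A i z \<inter> P i z) x"
  shows "\<exists>x\<in>Pi\<^sub>E I D. \<forall>i\<in>I.
           x i \<in> closure_map (choice_topology I E X) (subtopology (E i) (X i)) (B i) x \<and>
           A i x \<inter> P i x = {}"
proof -
  let ?S = "choice_topology I E X" and ?Z = "choice_topology I E D"
  let ?Y = "\<lambda>i. subtopology (E i) (X i)" and ?Y' = "\<lambda>i. subtopology (E i) (D i)"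
  let ?sel = "\<lambda>i. selector_map ?S (?Y i) (W i) (H i) (B i) (D i)"
  have lc: "locally_convex_tvs_on (E i)" and haus: "Hausdorff_space (E i)" and tvs: "tvs_on (E i)" if "i \<in> I" for i
    using c1_E[OF that] by (auto simp: locally_convex_tvs_on_def)
  have X: "X i \<subseteq> topspace (E i)" if "i \<in> I" for i using c1_X[OF that] by simp
  have D: "D i \<noteq> {}" "D i \<subseteq> X i" "compactin (E i) (D i)" "convex (D i)" if "i \<in> I" for i
    using c1_D[OF that] by simp_all
  have topS: "topspace ?S = Pi\<^sub>E I X"
    using X unfolding choice_topology_def topspace_product_topology o_def by (intro PiE_cong) auto
  have Z: "compact_space ?Z" and topZ: "topspace ?Z = Pi\<^sub>E I D"
    using choice_topology_compact_Hausdorff[of I E D] haus D(3) by auto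
  have DX: "x \<in> Pi\<^sub>E I X" if "x \<in> Pi\<^sub>E I D" for x
    using that D(2) by (auto simp: PiE_iff)
  have Wsub: "W i \<subseteq> Pi\<^sub>E I X" if "i \<in> I" for i
    using openin_subset[OF c3[OF that]] topS by simp
  have HB: "H i x \<subseteq> B i x" if "i \<in> I" "x \<in> W i" for i x
  proof -
    have x: "x \<in> Pi\<^sub>E I X" using Wsub that by blast
    show ?thesis using H_def[OF that(1) x] c2[OF that(1) x] by simp
  qed
  have closed_D: "closedin (?Y i) (D i)" if "i \<in> I" for i
    using compactin_imp_closedin[OF haus D(3)] D(2) that by (simp add: closedin_subset_topspace)
  have mem_sel: "y \<in> ?sel i V x \<longleftrightarrow>
     (x, y) \<in> prod_topology ?S (?Y i) closure_of (Sigma (Pi\<^sub>E I X) (thickened_map (B i) V (D i))) \<and>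
     (x \<in> W i \<longrightarrow> (x, y) \<in> prod_topology ?S (?Y i) closure_of (Sigma (W i) (thickened_map (H i) V (D i))))"
    if "i \<in> I" for i V x y
    unfolding topS[symmetric] by (rule mem_selector_map_iff[OF c3[OF that] HB[OF that]])
  have sel_D: "?sel i V x \<subseteq> D i" if "i \<in> I" for i V x
    by (rule selector_map_subset[OF c3[OF that] HB[OF that] closed_D[OF that]])
  have sel_mono: "?sel i V x \<subseteq> ?sel i V' x" if "i \<in> I" "V \<subseteq> V'" for i V V' x
    by (rule selector_map_mono[OF c3[OF that(1)] HB[OF that(1)] that(2)])
  have sel_convex: "?sel i V x \<noteq> {} \<and> convex (?sel i V x)"
    if "i \<in> I" "convex_nhd (E i) V" "x \<in> Pi\<^sub>E I D" for i V x
    using c4_conv[of i V x] c5_conv[of i V x] that DX[OF that(3)]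
    by (simp add: selector_map_def convex_nhd_def)
  \<comment> \<open>Closedness is known over \<open>Pi\<^sub>E I X\<close> and is pulled back along
    the inclusions of the smaller sets. All values lie in \<open>D i\<close>, so shrinking the
    codomain loses none of them.\<close>
  have sel_graph: "closedin (prod_topology ?Z (?Y' i)) (Sigma (Pi\<^sub>E I D) (?sel i V))"
    if i: "i \<in> I" for i V
  proof -
    let ?Q = "prod_topology ?Z (?Y' i)" and ?G = "{p. snd p \<in> ?sel i V (fst p)}"
    have "continuous_map (?Y' i) (?Y i) (\<lambda>y. y)"
      using D(2)[OF i] by (auto simp: continuous_map_in_subtopology)
    then have "continuous_map ?Q (prod_topology ?S (?Y i)) (\<lambda>p. (fst p, snd p))"
      using D(2) by (intro continuous_map_pairedI
          continuous_map_compose[OF continuous_map_fst continuous_map_choice_topology_mono, unfolded o_def]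
          continuous_map_compose[OF continuous_map_snd, unfolded o_def])
    then have "closedin ?Q {p \<in> topspace ?Q. (fst p, snd p) \<in> ?G}"
      by (rule closedin_continuous_map_preimage) (rule closedin_selector_graph[OF c3[OF i] HB[OF i]])
    moreover have "topspace (?Y' i) = D i" using D(2)[OF i] X[OF i] by auto
    then have "{p \<in> topspace ?Q. (fst p, snd p) \<in> ?G} = Sigma (Pi\<^sub>E I D) (?sel i V)"
      using sel_D[OF i, of V] by (auto simp: topZ)
    ultimately show ?thesis by simp
  qed
  have fixed_point: "\<exists>x\<in>Pi\<^sub>E I D. \<forall>i\<in>I. x i \<in> ?sel i (V i) x" if V: "\<And>i. i \<in> I \<Longrightarrow> convex_nhd (E i) (V i)" for V
  proof (rule Kakutani_Fan_Glicksberg_product)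
    show "closedin (prod_topology ?Z (?Y' i)) (Sigma (Pi\<^sub>E I D) (?sel i (V i)))" if "i \<in> I" for i
      by (rule sel_graph[OF that])
    show "?sel i (V i) x \<noteq> {} \<and> convex (?sel i (V i) x) \<and> ?sel i (V i) x \<subseteq> D i"
      if "i \<in> I" "x \<in> Pi\<^sub>E I D" for i x
      using sel_convex[OF that(1) V[OF that(1)] that(2)] sel_D[OF that(1)] by simp
  qed (use lc haus D in simp_all)
  \<comment> \<open>A preimage of the graph under \<open>x \<mapsto> (x, x i)\<close>, hence closed.
    Indexing by single pairs instead of whole families of neighbourhoods leaves only finitely many
    neighbourhoods per agent in a finite subfamily.\<close>
  define fix_set where "fix_set = (\<lambda>(i, V). {x \<in> topspace ?Z. (x, x i) \<in> Sigma (Pi\<^sub>E I D) (?sel i V)})"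
  define \<I> where "\<I> = {(i, V). i \<in> I \<and> convex_nhd (E i) V}"
  have "\<Inter>(fix_set ` \<I>) \<noteq> {}"
  proof (rule Z[unfolded compact_space_fip, rule_format], intro conjI ballI allI impI)
    fix C assume "C \<in> fix_set ` \<I>"
    then obtain i V where i: "i \<in> I" and C: "C = fix_set (i, V)" by (auto simp: \<I>_def)
    have "continuous_map ?Z (prod_topology ?Z (?Y' i)) (\<lambda>x. (x, x i))"
      unfolding choice_topology_def
      by (intro continuous_map_pairedI continuous_map_product_projection i) simp
    then show "closedin ?Z C"
      unfolding C fix_set_def by (simp only: prod.case closedin_continuous_map_preimage[OF _ sel_graph[OF i]])
  next
    fix \<F> assume "finite \<F> \<and> \<F> \<subseteq> fix_set ` \<I>"
    then obtain \<J> where \<J>: "\<J> \<subseteq> \<I>" "finite \<J>" and \<F>: "\<F> = fix_set ` \<J>"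
      by (meson finite_subset_image)
    \<comment> \<open>Agents without a pair in \<open>\<J>\<close> receive the whole space. For the
      others \<open>V i\<close> is contained in every listed neighbourhood, so by monotonicity one
      fixed point for \<open>V\<close> lies in all the sets of the subfamily.\<close>
    define V where "V i = topspace (E i) \<inter> \<Inter>{V. (i, V) \<in> \<J>}" for i
    have "convex_nhd (E i) (V i)" if "i \<in> I" for i
      unfolding V_def
    proof (rule convex_nhd_Inter[OF tvs[OF that]])
      have "{V. (i, V) \<in> \<J>} \<subseteq> snd ` \<J>" by (auto simp: image_iff Bex_def)
      then show "finite {V. (i, V) \<in> \<J>}" using \<J>(2) by (meson finite_imageI finite_subset)
      show "convex_nhd (E i) U" if "U \<in> {V. (i, V) \<in> \<J>}" for U
        using that \<J>(1) by (auto simp: \<I>_def)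
    qed
    then obtain x where x: "x \<in> Pi\<^sub>E I D" and fp: "\<And>i. i \<in> I \<Longrightarrow> x i \<in> ?sel i (V i) x"
      using fixed_point[of V] by metis
    have "x \<in> fix_set (i, U)" if "(i, U) \<in> \<J>" for i U
    proof -
      have i: "i \<in> I" using that \<J>(1) by (auto simp: \<I>_def)
      have "V i \<subseteq> U" using that by (auto simp: V_def)
      then have "x i \<in> ?sel i U x" by (rule subsetD[OF sel_mono[OF i] fp[OF i]])
      then show ?thesis using x by (simp add: fix_set_def topZ)
    qed
    then have "x \<in> \<Inter>\<F>" unfolding \<F> by auto
    then show "\<Inter>\<F> \<noteq> {}" by blast
  qed
  then obtain x where x: "\<And>i V. i \<in> I \<Longrightarrow> convex_nhd (E i) V \<Longrightarrow> x \<in> fix_set (i, V)"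
    by (auto simp: \<I>_def)
  have xD: "x \<in> Pi\<^sub>E I D"
  proof -
    \<comment> \<open>Membership of \<open>x\<close> in the product is read off from the set of one
      agent with the whole space as neighbourhood; an empty family of agents would leave
      \<open>x\<close> arbitrary.\<close>
    obtain i where "i \<in> I" using economy by (auto simp: abstract_economy_def)
    then show ?thesis using x[OF _ convex_nhd_topspace[OF tvs]] by (simp add: fix_set_def topZ)
  qed
  have x_sel: "x i \<in> ?sel i V x" if "i \<in> I" "convex_nhd (E i) V" for i V
    using x[OF that] by (simp add: fix_set_def)
  have xX: "x \<in> Pi\<^sub>E I X" by (rule DX[OF xD])
  show ?thesis
  proof (intro bexI[OF _ xD] ballI conjI)
    fix i assume i: "i \<in> I"
    have val: "A i z \<inter> P i z \<subseteq> X i" "B i z \<subseteq> X i" if "z \<in> Pi\<^sub>E I X" for z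
    proof -
      have "A i \<in> Pi\<^sub>E I X \<rightarrow> Pow (X i)" "B i \<in> Pi\<^sub>E I X \<rightarrow> Pow (X i)"
        using economy i by (simp_all add: abstract_economy_def)
      then have "A i z \<in> Pow (X i)" "B i z \<in> Pow (X i)"
        using that by (simp_all only: funcset_mem)
      then show "A i z \<inter> P i z \<subseteq> X i" "B i z \<subseteq> X i" by auto
    qed
    have "(x, x i) \<in> prod_topology ?S (?Y i) closure_of (Sigma (Pi\<^sub>E I X) (B i))"
    proof (rule closure_of_thickened_limit[OF lc[OF i] X[OF i]])
      show "B i z \<subseteq> X i" if "z \<in> Pi\<^sub>E I X" for z by (rule val(2)[OF that])
      show "(x, x i) \<in> prod_topology ?S (?Y i) closure_of (Sigma (Pi\<^sub>E I X) (thickened_map (B i) V (D i)))"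
        if "convex_nhd (E i) V" for V
        using x_sel[OF i that] mem_sel[OF i] by simp
    qed
    then show "x i \<in> closure_map ?S (?Y i) (B i) x"
      by (simp add: mem_closure_map_iff topS)
    have "x \<notin> W i"
    proof
      assume "x \<in> W i"
      have "(x, x i) \<in> prod_topology ?S (?Y i) closure_of (Sigma (W i) (H i))"
      proof (rule closure_of_thickened_limit[OF lc[OF i] X[OF i]])
        show "H i z \<subseteq> X i" if "z \<in> W i" for z
        proof -
          have z: "z \<in> Pi\<^sub>E I X" by (rule subsetD[OF Wsub[OF i] that])
          show ?thesis using val(1)[OF z] H_def[OF i z] by simp
        qed
        show "(x, x i) \<in> prod_topology ?S (?Y i) closure_of (Sigma (W i) (thickened_map (H i) V (D i)))"
          if "convex_nhd (E i) V" for V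
          using x_sel[OF i that] mem_sel[OF i] \<open>x \<in> W i\<close> by simp
      qed
      \<comment> \<open>The limit is taken over \<open>W i\<close>, the domain of
        \<open>H i\<close>, whereas the excluded closure is that of the graph over the whole
        product.\<close>
      also have "\<dots> \<subseteq> prod_topology ?S (?Y i) closure_of (Sigma (Pi\<^sub>E I X) (\<lambda>z. A i z \<inter> P i z))"
      proof (intro closure_of_mono Sigma_mono Wsub[OF i])
        fix z assume "z \<in> W i"
        then show "H i z \<subseteq> A i z \<inter> P i z" using H_def[OF i subsetD[OF Wsub[OF i]]] by simp
      qed
      finally show False
        using c6[OF i xX] by (simp add: mem_closure_map_iff topS)
    qed
    then show "A i x \<inter> P i x = {}" using W_def[OF i] xX by simp
  qed
qed

end
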